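(* The set $\{E_2^{n_1}E_{12}^{n_2}E_{11212}^{n_3}E_{112}^{n_4}E_{1112}^{n_5}E_1^{n_6}\mid n_1,\dots,n_6\in\mathbb{N}\}$ (where $\mathbb N$ includes $0$) is a basis (the Lyndon basis), as a $\mathbb{K}$-vector space, of the algebra $U^+$.
   Context: $\mathbb{K}=\mathbb{Q}(r,s)$ is the field of rational functions in two indeterminates $r,s$. Put $r_1=r$, $s_1=s$, $r_2=r^3$, $s_2=s^3$, and $\langle\omega_1',\omega_1\rangle=rs^{-1}$, $\langle\omega_1',\omega_2\rangle=r^{-3}$, $\langle\omega_2',\omega_1\rangle=s^3$, $\langle\omega_2',\omega_2\rangle=r^3s^{-3}$. $U=U_{r,s}(G_2)$ is the unital associative $\mathbb{K}$-algebra generated by $e_i,f_i,\omega_i^{\pm1},\omega_i'^{\pm1}$ ($i=1,2$) with relations: (G1) all $\omega_i^{\pm1},\omega_j'^{\pm1}$ commute with each other, and $\omega_i\omega_i^{-1}=1=\omega_j'\omega_j'^{-1}$; (G2) $\omega_je_i\omega_j^{-1}=\langle\omega_i',\omega_j\rangle e_i$, $\omega_jf_i\omega_j^{-1}=\langle\omega_i',\omega_j\rangle^{-1}f_i$; (G3) $\omega_j'e_i\omega_j'^{-1}=\langle\omega_j',\omega_i\rangle^{-1}e_i$, $\omega_j'f_i\omega_j'^{-1}=\langle\omega_j',\omega_i\rangle f_i$; (G4) $e_if_j-f_je_i=\delta_{ij}\frac{\omega_i-\omega_i'}{r_i-s_i}$; (G5) $e_2^2e_1-(r^{-3}+s^{-3})e_2e_1e_2+(rs)^{-3}e_1e_2^2=0$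 and $e_1^4e_2-(r+s)(r^2+s^2)e_1^3e_2e_1+rs(r^2+s^2)(r^2+rs+s^2)e_1^2e_2e_1^2-(rs)^3(r+s)(r^2+s^2)e_1e_2e_1^3+(rs)^6e_2e_1^4=0$; (G6) $f_1f_2^2-(r^{-3}+s^{-3})f_2f_1f_2+(rs)^{-3}f_2^2f_1=0$ and $f_2f_1^4-(r+s)(r^2+s^2)f_1f_2f_1^3+rs(r^2+s^2)(r^2+rs+s^2)f_1^2f_2f_1^2-(rs)^3(r+s)(r^2+s^2)f_1^3f_2f_1+(rs)^6f_1^4f_2=0$. $U^+$ is the subalgebra of $U$ generated by $e_1,e_2$. Quantum root vectors in $U^+$: $E_1=e_1$, $E_2=e_2$, $E_{12}=e_1e_2-s^3e_2e_1$, $E_{112}=e_1E_{12}-rs^2E_{12}e_1$, $E_{1112}=e_1E_{112}-r^2sE_{112}e_1$, $E_{11212}=E_{112}E_{12}-r^2sE_{12}E_{112}$. *)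

theory Defs
  imports
    "HOL-Computational_Algebra.Polynomial"
    "HOL-Computational_Algebra.Fraction_Field"
    "HOL-Library.Poly_Mapping"
begin

section \<open>The ground field \<open>\<rat>(r,s)\<close>\<close>

text \<open>The fraction field of \<open>\<rat>[r][s]\<close>: the inner polynomial variable is \<open>r\<close>, the outer one is \<open>s\<close>.\<close>

type_synonym K = "rat poly poly fract"

definition rr :: K where "rr = Fract [:[:0, 1:]:] 1"

definition ss :: K where "ss = Fract [:0, 1:] 1"


section \<open>The free associative algebra on the generators\<close>

datatype idx = I1 | I2

datatype gen = Ge idx | Gf idx | Gom idx | Gominv idx | Gom' idx | Gominv' idx

text \<open>
  Words form a monoid under concatenation. It is written additively because the
  convolution product of finitely supported functions is the one for additive monoids.
\<close>

datatype word = Word (letters: "gen list")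

instantiation word :: monoid_add
begin

definition zero_word :: word where "0 = Word []"

definition plus_word :: "word \<Rightarrow> word \<Rightarrow> word"
  where "v + w = Word (letters v @ letters w)"

instance
  by standard (simp_all add: zero_word_def plus_word_def)

end

type_synonym free_alg = "word \<Rightarrow>\<^sub>0 K"

definition fgen :: "gen \<Rightarrow> free_alg"
  where "fgen x = Poly_Mapping.single (Word [x]) 1"

definition fscale :: "K \<Rightarrow> free_alg \<Rightarrow> free_alg"  (infixr "*\<^sub>F" 75)
  where "c *\<^sub>F p = Poly_Mapping.single 0 c * p"


section \<open>The defining relations\<close>

fun r_of :: "idx \<Rightarrow> K" where
  "r_of I1 = rr"
| "r_of I2 = rr ^ 3"

fun s_of :: "idx \<Rightarrow> K" where
  "s_of I1 = ss"
| "s_of I2 = ss ^ 3"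

text \<open>\<open>pairing i j\<close> is \<open>\<langle>\<omega>\<^sub>i', \<omega>\<^sub>j\<rangle>\<close>.\<close>

fun pairing :: "idx \<Rightarrow> idx \<Rightarrow> K" where
  "pairing I1 I1 = rr * inverse ss"
| "pairing I1 I2 = inverse (rr ^ 3)"
| "pairing I2 I1 = ss ^ 3"
| "pairing I2 I2 = rr ^ 3 * inverse (ss ^ 3)"

abbreviation "fe i \<equiv> fgen (Ge i)"
abbreviation "ff i \<equiv> fgen (Gf i)"
abbreviation "fom i \<equiv> fgen (Gom i)"
abbreviation "fominv i \<equiv> fgen (Gominv i)"
abbreviation "fom' i \<equiv> fgen (Gom' i)"
abbreviation "fominv' i \<equiv> fgen (Gominv' i)"

definition torus_gens :: "gen set"
  where "torus_gens = range Gom \<union> range Gominv \<union> range Gom' \<union> range Gominv'"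

text \<open>\<open>G2_rel a b\<close> means that \<open>a = b\<close> is one of the defining relations of \<open>U\<^sub>r\<^sub>,\<^sub>s(G\<^sub>2)\<close>.\<close>

inductive G2_rel :: "free_alg \<Rightarrow> free_alg \<Rightarrow> bool" where
  comm: "x \<in> torus_gens \<Longrightarrow> y \<in> torus_gens \<Longrightarrow> G2_rel (fgen x * fgen y) (fgen y * fgen x)"
| om_inv: "G2_rel (fom i * fominv i) 1"
| om'_inv: "G2_rel (fom' i * fominv' i) 1"
| om_e: "G2_rel (fom j * fe i * fominv j) (pairing i j *\<^sub>F fe i)"
| om_f: "G2_rel (fom j * ff i * fominv j) (inverse (pairing i j) *\<^sub>F ff i)"
| om'_e: "G2_rel (fom' j * fe i * fominv' j) (inverse (pairing j i) *\<^sub>F fe i)"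
| om'_f: "G2_rel (fom' j * ff i * fominv' j) (pairing j i *\<^sub>F ff i)"
| ef: "G2_rel (fe i * ff j - ff j * fe i)
     (if i = j then inverse (r_of i - s_of i) *\<^sub>F (fom i - fom' i) else 0)"
| serre_e21: "G2_rel
     (fe I2 ^ 2 * fe I1
      - (inverse (rr ^ 3) + inverse (ss ^ 3)) *\<^sub>F (fe I2 * fe I1 * fe I2)
      + inverse ((rr * ss) ^ 3) *\<^sub>F (fe I1 * fe I2 ^ 2)) 0"
| serre_e12: "G2_rel
     (fe I1 ^ 4 * fe I2
      - ((rr + ss) * (rr ^ 2 + ss ^ 2)) *\<^sub>F (fe I1 ^ 3 * fe I2 * fe I1)
      + (rr * ss * (rr ^ 2 + ss ^ 2) * (rr ^ 2 + rr * ss + ss ^ 2)) *\<^sub>F (fe I1 ^ 2 * fe I2 * fe I1 ^ 2)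
      - ((rr * ss) ^ 3 * (rr + ss) * (rr ^ 2 + ss ^ 2)) *\<^sub>F (fe I1 * fe I2 * fe I1 ^ 3)
      + ((rr * ss) ^ 6) *\<^sub>F (fe I2 * fe I1 ^ 4)) 0"
| serre_f21: "G2_rel
     (ff I1 * ff I2 ^ 2
      - (inverse (rr ^ 3) + inverse (ss ^ 3)) *\<^sub>F (ff I2 * ff I1 * ff I2)
      + inverse ((rr * ss) ^ 3) *\<^sub>F (ff I2 ^ 2 * ff I1)) 0"
| serre_f12: "G2_rel
     (ff I2 * ff I1 ^ 4
      - ((rr + ss) * (rr ^ 2 + ss ^ 2)) *\<^sub>F (ff I1 * ff I2 * ff I1 ^ 3)
      + (rr * ss * (rr ^ 2 + ss ^ 2) * (rr ^ 2 + rr * ss + ss ^ 2)) *\<^sub>F (ff I1 ^ 2 * ff I2 * ff I1 ^ 2)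
      - ((rr * ss) ^ 3 * (rr + ss) * (rr ^ 2 + ss ^ 2)) *\<^sub>F (ff I1 ^ 3 * ff I2 * ff I1)
      + ((rr * ss) ^ 6) *\<^sub>F (ff I1 ^ 4 * ff I2)) 0"

text \<open>
  The two-sided ideal generated by the differences \<open>a - b\<close>, as the set of finite sums of
  elements \<open>p * (a - b) * q\<close>.
\<close>

inductive_set G2_ideal :: "free_alg set" where
  zero: "0 \<in> G2_ideal"
| add_gen: "G2_rel a b \<Longrightarrow> z \<in> G2_ideal \<Longrightarrow> p * (a - b) * q + z \<in> G2_ideal"

lemma G2_ideal_add: "x \<in> G2_ideal \<Longrightarrow> y \<in> G2_ideal \<Longrightarrow> x + y \<in> G2_ideal"
  by (induction rule: G2_ideal.induct) (auto simp: add.assoc intro: G2_ideal.intros)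

lemma G2_ideal_mult_left: "x \<in> G2_ideal \<Longrightarrow> u * x \<in> G2_ideal"
proof (induction rule: G2_ideal.induct)
  case (add_gen a b z p q)
  then have "(u * p) * (a - b) * q + u * z \<in> G2_ideal"
    by (intro G2_ideal.add_gen)
  then show ?case
    by (simp only: distrib_left mult.assoc)
qed (simp add: G2_ideal.zero)

lemma G2_ideal_mult_right: "x \<in> G2_ideal \<Longrightarrow> x * u \<in> G2_ideal"
proof (induction rule: G2_ideal.induct)
  case (add_gen a b z p q)
  then have "p * (a - b) * (q * u) + z * u \<in> G2_ideal"
    by (intro G2_ideal.add_gen)
  then show ?case
    by (simp only: distrib_right mult.assoc)
qed (simp add: G2_ideal.zero)

lemma G2_ideal_uminus: "x \<in> G2_ideal \<Longrightarrow> - x \<in> G2_ideal"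
  using G2_ideal_mult_left[of x "- 1"] by simp


section \<open>The algebra \<open>U\<^sub>r\<^sub>,\<^sub>s(G\<^sub>2)\<close>\<close>

definition G2_cong :: "free_alg \<Rightarrow> free_alg \<Rightarrow> bool"
  where "G2_cong p q \<longleftrightarrow> p - q \<in> G2_ideal"

lemma G2_cong_refl: "G2_cong p p"
  by (simp add: G2_cong_def G2_ideal.zero)

lemma equivp_G2_cong: "equivp G2_cong"
proof (rule equivpI)
  show "reflp G2_cong"
    by (simp add: reflp_def G2_cong_def G2_ideal.zero)
  show "symp G2_cong"
  proof (rule sympI)
    fix p q
    assume "G2_cong p q"
    then have "- (p - q) \<in> G2_ideal"
      unfolding G2_cong_def by (rule G2_ideal_uminus)
    then show "G2_cong q p"
      by (simp add: G2_cong_def)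
  qed
  show "transp G2_cong"
  proof (rule transpI)
    fix p q t
    assume "G2_cong p q" "G2_cong q t"
    then have "(p - q) + (q - t) \<in> G2_ideal"
      unfolding G2_cong_def by (rule G2_ideal_add)
    then show "G2_cong p t"
      by (simp add: G2_cong_def)
  qed
qed

quotient_type UG2 = free_alg / G2_cong
  by (rule equivp_G2_cong)

instantiation UG2 :: "{ring, monoid_mult}"
begin

lift_definition zero_UG2 :: UG2 is 0 .

lift_definition one_UG2 :: UG2 is 1 .

lift_definition plus_UG2 :: "UG2 \<Rightarrow> UG2 \<Rightarrow> UG2" is "(+)"
proof -
  fix p p' q q'
  assume "G2_cong p p'" "G2_cong q q'"
  then have "(p - p') + (q - q') \<in> G2_ideal"
    unfolding G2_cong_def by (rule G2_ideal_add)
  then show "G2_cong (p + q) (p' + q')"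
    by (simp only: G2_cong_def add_diff_add)
qed

lift_definition uminus_UG2 :: "UG2 \<Rightarrow> UG2" is uminus
proof -
  fix p p'
  assume "G2_cong p p'"
  then have "- (p - p') \<in> G2_ideal"
    unfolding G2_cong_def by (rule G2_ideal_uminus)
  then show "G2_cong (- p) (- p')"
    by (simp only: G2_cong_def minus_diff_minus)
qed

lift_definition minus_UG2 :: "UG2 \<Rightarrow> UG2 \<Rightarrow> UG2" is "(-)"
proof -
  fix p p' q q'
  assume "G2_cong p p'" "G2_cong q q'"
  then have "(p - p') + - (q - q') \<in> G2_ideal"
    unfolding G2_cong_def by (intro G2_ideal_add G2_ideal_uminus)
  then show "G2_cong (p - q) (p' - q')"
    by (simp add: G2_cong_def algebra_simps)
qed

lift_definition times_UG2 :: "UG2 \<Rightarrow> UG2 \<Rightarrow> UG2" is "(*)"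
proof -
  fix p p' q q'
  assume "G2_cong p p'" "G2_cong q q'"
  then have "(p - p') * q + p' * (q - q') \<in> G2_ideal"
    unfolding G2_cong_def by (intro G2_ideal_add G2_ideal_mult_left G2_ideal_mult_right)
  then show "G2_cong (p * q) (p' * q')"
    by (simp add: G2_cong_def algebra_simps)
qed

instance
proof
  fix x y z :: UG2
  show "x + y + z = x + (y + z)" by transfer (simp add: add.assoc G2_cong_refl)
  show "x + y = y + x" by transfer (simp add: add.commute G2_cong_refl)
  show "0 + x = x" by transfer (simp add: G2_cong_refl)
  show "- x + x = 0" by transfer (simp add: G2_cong_refl)
  show "x - y = x + - y" by transfer (simp add: G2_cong_refl)
  show "x * y * z = x * (y * z)" by transfer (simp add: mult.assoc G2_cong_refl)
  show "(x + y) * z = x * z + y * z" by transfer (simp add: distrib_right G2_cong_refl)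
  show "x * (y + z) = x * y + x * z" by transfer (simp add: distrib_left G2_cong_refl)
  show "1 * x = x" by transfer (simp add: G2_cong_refl)
  show "x * 1 = x" by transfer (simp add: G2_cong_refl)
qed

end

lift_definition Uscale :: "K \<Rightarrow> UG2 \<Rightarrow> UG2"  (infixr "*\<^sub>U" 75) is fscale
  unfolding G2_cong_def fscale_def
  by (simp add: G2_ideal_mult_left flip: right_diff_distrib)

global_interpretation U: vector_space Uscale
proof
  fix a b :: K and x y :: UG2
  show "a *\<^sub>U (x + y) = a *\<^sub>U x + a *\<^sub>U y"
    by transfer (simp add: fscale_def distrib_left G2_cong_refl)
  show "(a + b) *\<^sub>U x = a *\<^sub>U x + b *\<^sub>U x"
    by transfer (simp add: fscale_def single_add distrib_right G2_cong_refl)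
  show "a *\<^sub>U b *\<^sub>U x = (a * b) *\<^sub>U x"
    by transfer (simp add: fscale_def mult_single G2_cong_refl flip: mult.assoc)
  show "1 *\<^sub>U x = x"
    by transfer (simp add: fscale_def G2_cong_refl)
qed

lift_definition Ugen :: "gen \<Rightarrow> UG2" is fgen .

definition e1 :: UG2 where "e1 = Ugen (Ge I1)"

definition e2 :: UG2 where "e2 = Ugen (Ge I2)"


section \<open>The subalgebra \<open>U\<^sup>+\<close> and its quantum root vectors\<close>

inductive_set subalg_gen :: "UG2 set \<Rightarrow> UG2 set" for S :: "UG2 set" where
  base: "x \<in> S \<Longrightarrow> x \<in> subalg_gen S"
| one: "1 \<in> subalg_gen S"
| scale: "x \<in> subalg_gen S \<Longrightarrow> c *\<^sub>U x \<in> subalg_gen S"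
| add: "x \<in> subalg_gen S \<Longrightarrow> y \<in> subalg_gen S \<Longrightarrow> x + y \<in> subalg_gen S"
| mult: "x \<in> subalg_gen S \<Longrightarrow> y \<in> subalg_gen S \<Longrightarrow> x * y \<in> subalg_gen S"

definition Uplus :: "UG2 set" where "Uplus = subalg_gen {e1, e2}"

definition E1 :: UG2 where "E1 = e1"

definition E2 :: UG2 where "E2 = e2"

definition E12 :: UG2 where "E12 = e1 * e2 - (ss ^ 3) *\<^sub>U (e2 * e1)"

definition E112 :: UG2 where "E112 = e1 * E12 - (rr * ss ^ 2) *\<^sub>U (E12 * e1)"

definition E1112 :: UG2 where "E1112 = e1 * E112 - (rr ^ 2 * ss) *\<^sub>U (E112 * e1)"

definition E11212 :: UG2 where "E11212 = E112 * E12 - (rr ^ 2 * ss) *\<^sub>U (E12 * E112)"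

definition lyndon_monomial :: "nat \<times> nat \<times> nat \<times> nat \<times> nat \<times> nat \<Rightarrow> UG2" where
  "lyndon_monomial = (\<lambda>(n1, n2, n3, n4, n5, n6).
     E2 ^ n1 * E12 ^ n2 * E11212 ^ n3 * E112 ^ n4 * E1112 ^ n5 * E1 ^ n6)"

end

theory Submission
  imports Defs "HOL-Library.Multiset"
begin

text \<open>
  Spanning: the Serre relations imply straightening relations among the quantum root vectors, each
  obtained from the previous one by a skew commutator with \<open>e\<^sub>1\<close>. They show that the span of the
  ordered monomials is stable under left multiplication by \<open>e\<^sub>1\<close> and \<open>e\<^sub>2\<close>.

  Independence: the Feigin homomorphism for the reduced word \<open>121212\<close> sends \<open>e\<^sub>1\<close> and \<open>e\<^sub>2\<close> to sums of
  three generators each of a quantum polynomial ring in six variables. For a suitable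
  weight the leading exponents of the images of the six root vectors are linearly independent, so
  the monomials have distinct leading exponents. This concerns the algebra
  defined by the Serre relations alone; that \<open>U\<close> imposes on \<open>e\<^sub>1, e\<^sub>2\<close> no relations beyond the Serre relations is seen from the action of \<open>U\<close> on
  the lowest weight Verma module, divided by the ideal generated by the Serre elements. Dually, all functionals on
  words that vanish on this ideal are acted on by \<open>U\<close> from the right, and the coefficients of the
  Feigin images are such functionals.
\<close>

section \<open>Straightening relations\<close>

locale algebra_over = vector_space scale
  for scale :: "'k::field \<Rightarrow> 'a::{ring,monoid_mult} \<Rightarrow> 'a" (infixr "*s" 75) +
  assumes scale_mult_left: "(c *s x) * y = c *s (x * y)"
    and scale_mult_right: "x * (c *s y) = c *s (x * y)"
begin

lemmas normalize = scale_mult_left scale_mult_right eval_nat_numeral power_Suc algebra_simps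

lemma left_rule: "x * y = z \<Longrightarrow> x * (y * w) = z * w" for x :: 'a
  by (simp only: mult.assoc[symmetric])

lemma scale_cancel: "k \<noteq> 0 \<Longrightarrow> k *s x = k *s y \<Longrightarrow> x = y"
  by simp

end

text \<open>The generators \<open>a\<close>, \<open>b\<close> are arbitrary because the same
  expressions are needed in \<open>U\<close>, in the free algebra, among the operators on word
  functionals and in the quantum torus.\<close>

locale root_vectors = algebra_over scale
  for scale :: "'k::field \<Rightarrow> 'a::{ring,monoid_mult} \<Rightarrow> 'a" (infixr "*s" 75) +
  fixes r s :: 'k and a b :: 'a
begin

definition "X12 = a * b - s ^ 3 *s (b * a)"
definition "X112 = a * X12 - (r * s ^ 2) *s (X12 * a)"
definition "X1112 = a * X112 - (r ^ 2 * s) *s (X112 * a)"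
definition "X11212 = X112 * X12 - (r ^ 2 * s) *s (X12 * X112)"

definition "lyndon = (\<lambda>(n1, n2, n3, n4, n5, n6).
  b ^ n1 * X12 ^ n2 * X11212 ^ n3 * X112 ^ n4 * X1112 ^ n5 * a ^ n6)"

lemma a_b: "a * b = s ^ 3 *s (b * a) + X12"
  and a_X12: "a * X12 = (r * s ^ 2) *s (X12 * a) + X112"
  and a_X112: "a * X112 = (r ^ 2 * s) *s (X112 * a) + X1112"
  and X112_X12: "X112 * X12 = (r ^ 2 * s) *s (X12 * X112) + X11212"
  by (simp_all add: X12_def X112_def X1112_def X11212_def)

end

text \<open>The Serre relations enter as skew commutations; \<open>S21_eq\<close> and
  \<open>S12_eq\<close> below match them with their defining form. The scalars in \<open>nz\<close>
  are the factors that the derivations cancel.\<close>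

locale serre_algebra = root_vectors +
  assumes serre1: "X12 * b = r ^ 3 *s (b * X12)"
    and serre2: "a * X1112 = r ^ 3 *s (X1112 * a)"
    and nz: "r \<noteq> 0" "s \<noteq> 0" "r + s \<noteq> 0" "r ^ 2 + s ^ 2 \<noteq> 0" "r ^ 2 - r * s + s ^ 2 \<noteq> 0"
begin

text \<open>
  In each of the following relations, written as \<open>Q = 0\<close>, the next one is a scalar multiple of
  \<open>a * Q - q *s (Q * a)\<close> (or of \<open>Q * b - q *s (b * Q)\<close>) for the scalar \<open>q\<close> that cancels the terms
  ending in \<open>a\<close> (starting with \<open>b\<close>).
\<close>

lemmas a_moves = a_b a_X12 a_X112 serre2
lemmas a_moves' = a_moves a_moves[THEN left_rule]

lemma X112_b: "X112 * b = (r ^ 3 * s ^ 3) *s (b * X112) + (r ^ 3 - r * s ^ 2) *s (X12 * X12)"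
proof -
  define Q where "Q = X12 * b - r ^ 3 *s (b * X12)"
  have "X112 * b - ((r ^ 3 * s ^ 3) *s (b * X112) + (r ^ 3 - r * s ^ 2) *s (X12 * X12))
      = a * Q - (r * s ^ 5) *s (Q * a)"
    unfolding Q_def by (simp add: a_moves' normalize)
  moreover have "Q = 0" by (simp add: Q_def serre1)
  ultimately show ?thesis by simp
qed

lemma X1112_b: "X1112 * b = (r ^ 3 * s ^ 6) *s (b * X1112)
  + (r ^ 2 * s * (r ^ 3 - s ^ 3)) *s (X12 * X112) + (r * (r ^ 2 - r * s - s ^ 2)) *s X11212"
proof -
  define Q where "Q = X112 * b - (r ^ 3 * s ^ 3) *s (b * X112) - (r ^ 3 - r * s ^ 2) *s (X12 * X12)"
  have "X1112 * b - ((r ^ 3 * s ^ 6) *s (b * X1112)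
  + (r ^ 2 * s * (r ^ 3 - s ^ 3)) *s (X12 * X112) + (r * (r ^ 2 - r * s - s ^ 2)) *s X11212)
      = a * Q - (r^2 * s ^ 4) *s (Q * a)"
    unfolding Q_def by (simp add: a_moves' X112_X12 X112_X12[THEN left_rule] normalize)
  moreover have "Q = 0" by (simp add: Q_def X112_b)
  ultimately show ?thesis by simp
qed

lemma a_X11212_aux: "a * X11212 = (r ^ 3 * s ^ 3) *s (X11212 * a) + X1112 * X12 - (r ^ 3 * s ^ 3) *s (X12 * X1112)"
  unfolding X11212_def by (simp add: a_moves' normalize)

text \<open>Both \<open>a * X1112 * b\<close> and \<open>a * X11212\<close> contribute multiples of
  \<open>X1112 * X12\<close>. The total coefficient is \<open>r * s * (r + s)\<close>, of which
  \<open>r * s\<close> is cancelled here and \<open>r + s\<close> in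
  \<open>X1112_X12\<close>.\<close>

lemma X1112_X12_aux: "(r + s) *s (X1112 * X12) = (r ^ 3 * s ^ 3 * (r + s)) *s (X12 * X1112)
  + (r * (r ^ 3 - s ^ 3)) *s (X112 * X112)"
proof -
  define Q where "Q = X1112 * b - ((r ^ 3 * s ^ 6) *s (b * X1112)
  + (r ^ 2 * s * (r ^ 3 - s ^ 3)) *s (X12 * X112) + (r * (r ^ 2 - r * s - s ^ 2)) *s X11212)"
  have "(r * s) *s ((r + s) *s (X1112 * X12)) - (r * s) *s ((r ^ 3 * s ^ 3 * (r + s)) *s (X12 * X1112)
  + (r * (r ^ 3 - s ^ 3)) *s (X112 * X112))
      = a * Q - (r ^ 3 * s ^ 3) *s (Q * a)"
    unfolding Q_def by (simp add: a_moves' a_X11212_aux normalize)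
  moreover have "Q = 0" by (simp add: Q_def X1112_b)
  ultimately have "(r * s) *s ((r + s) *s (X1112 * X12))
    = (r * s) *s ((r ^ 3 * s ^ 3 * (r + s)) *s (X12 * X1112) + (r * (r ^ 3 - s ^ 3)) *s (X112 * X112))"
    by simp
  moreover have "r * s \<noteq> 0" using nz(1,2) by simp
  ultimately show ?thesis by (metis scale_cancel)
qed

definition "\<tau> = r * (r ^ 3 - s ^ 3) / (r + s)"

lemma tau: "(r + s) * \<tau> = r * (r ^ 3 - s ^ 3)"
  using nz by (simp add: \<tau>_def)

lemma X1112_X12: "X1112 * X12 = (r ^ 3 * s ^ 3) *s (X12 * X1112) + \<tau> *s (X112 * X112)"
proof -
  have "(r + s) *s (X1112 * X12) = (r + s) *s ((r ^ 3 * s ^ 3) *s (X12 * X1112) + \<tau> *s (X112 * X112))"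
    unfolding X1112_X12_aux scale_right_distrib scale_scale tau by (simp add: mult_ac)
  with nz(3) show ?thesis by (rule scale_cancel)
qed

lemma a_X11212: "a * X11212 = (r ^ 3 * s ^ 3) *s (X11212 * a) + \<tau> *s (X112 * X112)"
  by (simp add: a_X11212_aux X1112_X12)

lemma r3_minus_tau: "(r + s) * (r ^ 3 - \<tau>) = r * s * (r ^ 2 + s ^ 2)"
  unfolding right_diff_distrib tau by (simp add: eval_nat_numeral algebra_simps)

lemma r3_plus_tau: "(r + s) * (r ^ 3 * s ^ 3 + \<tau> * (r ^ 2 * s)) = r ^ 3 * (r * s * (r ^ 2 + s ^ 2))"
proof -
  have "(r + s) * (r ^ 3 * s ^ 3 + \<tau> * (r ^ 2 * s)) = (r + s) * (r ^ 3 * s ^ 3) + ((r + s) * \<tau>) * (r ^ 2 * s)"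
    by (simp add: algebra_simps)
  also have "\<dots> = r ^ 3 * (r * s * (r ^ 2 + s ^ 2))"
    unfolding tau by (simp add: eval_nat_numeral algebra_simps)
  finally show ?thesis .
qed

lemma r3_minus_tau_nz: "r ^ 3 - \<tau> \<noteq> 0"
  using r3_minus_tau nz by auto

text \<open>The brackets in \<open>X1112_X112\<close> and \<open>X112_X11212\<close> produce exactly
  the two coefficients compared here. Their ratio \<open>r ^ 3\<close> becomes the scalar of the
  skew commutation.\<close>

lemma r3_plus_tau': "r ^ 3 * s ^ 3 + \<tau> * (r ^ 2 * s) = (r ^ 3 - \<tau>) * r ^ 3"
proof -
  have "(r + s) * (r ^ 3 * s ^ 3 + \<tau> * (r ^ 2 * s)) = (r + s) * ((r ^ 3 - \<tau>) * r ^ 3)"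
    unfolding r3_plus_tau r3_minus_tau[symmetric] by (simp only: mult_ac)
  then show ?thesis using nz(3) by simp
qed

lemma X1112_X112: "X1112 * X112 = r ^ 3 *s (X112 * X1112)"
proof -
  define Q where "Q = X1112 * X12 - ((r ^ 3 * s ^ 3) *s (X12 * X1112) + \<tau> *s (X112 * X112))"
  have "(r ^ 3 - \<tau>) *s (X1112 * X112) - (r ^ 3 * s ^ 3 + \<tau> * (r ^ 2 * s)) *s (X112 * X1112)
      = a * Q - (r ^ 4 * s ^ 2) *s (Q * a)"
    unfolding Q_def by (simp add: a_moves' normalize)
  moreover have "Q = 0" by (simp add: Q_def X1112_X12)
  ultimately have "(r ^ 3 - \<tau>) *s (X1112 * X112) = (r ^ 3 - \<tau>) *s (r ^ 3 *s (X112 * X1112))"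
    unfolding r3_plus_tau' by simp
  with r3_minus_tau_nz show ?thesis by (rule scale_cancel)
qed

text \<open>The degree of \<open>X11212 * X12\<close> exceeds that of the relation for
  \<open>X1112 * X12\<close> by one \<open>b\<close>, so the bracket is taken with \<open>b\<close>.
  Keeping the factor \<open>r + s\<close> in \<open>Q\<close> avoids the fraction
  \<open>\<tau>\<close>.\<close>

lemma X11212_X12: "X11212 * X12 = r ^ 3 *s (X12 * X11212)"
proof -
  define Q where "Q = (r + s) *s (X1112 * X12) - (r ^ 3 * s ^ 3 * (r + s)) *s (X12 * X1112)
     - (r * (r ^ 3 - s ^ 3)) *s (X112 * X112)"
  note moves = serre1 X112_b X1112_b X112_X12
  have *: "Q * b - (r ^ 6 * s ^ 6) *s (b * Q)
    = (r ^ 2 * s ^ 2 * (r + s) * (r ^ 2 - r * s + s ^ 2)) *s (r ^ 3 *s (X12 * X11212) - X11212 * X12)"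
    unfolding Q_def by (simp add: moves moves[THEN left_rule] X1112_X12_aux normalize)
  have "Q = 0" by (simp add: Q_def X1112_X12_aux)
  then have "(r ^ 2 * s ^ 2 * (r + s) * (r ^ 2 - r * s + s ^ 2)) *s (r ^ 3 *s (X12 * X11212) - X11212 * X12) = 0"
    unfolding *[symmetric] by simp
  moreover have "r ^ 2 * s ^ 2 * (r + s) * (r ^ 2 - r * s + s ^ 2) \<noteq> 0" using nz by simp
  ultimately show ?thesis by (simp only: scale_eq_0_iff) simp
qed

lemma X112_X11212: "X112 * X11212 = r ^ 3 *s (X11212 * X112)"
proof -
  define Q where "Q = X11212 * X12 - r ^ 3 *s (X12 * X11212)"
  have "(r ^ 3 * s ^ 3 + \<tau> * (r ^ 2 * s)) *s (X11212 * X112) - (r ^ 3 - \<tau>) *s (X112 * X11212)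
      = a * Q - (r ^ 4 * s ^ 5) *s (Q * a)"
    unfolding Q_def
    by (simp add: a_moves' X112_X12 X112_X12[THEN left_rule]
       a_X11212 a_X11212[THEN left_rule] normalize)
  moreover have "Q = 0" by (simp add: Q_def X11212_X12)
  ultimately have "(r ^ 3 - \<tau>) *s (X112 * X11212) = (r ^ 3 - \<tau>) *s (r ^ 3 *s (X11212 * X112))"
    unfolding r3_plus_tau' by simp
  with r3_minus_tau_nz show ?thesis by (rule scale_cancel)
qed

end

section \<open>Spanning\<close>

context algebra_over
begin

definition "layer y S = span {y ^ n * x | n x. x \<in> S}"

lemma mult_span:
  assumes "v \<in> span B" "\<And>x. x \<in> B \<Longrightarrow> z * x \<in> span T"
  shows "z * v \<in> span T"
  using assms(1)
proof (induction rule: span_induct_alt)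
  case base
  then show ?case by (simp add: span_zero)
next
  case (step c x y)
  then show ?case
    by (simp add: distrib_left scale_mult_right assms(2) span_add span_scale)
qed

lemma layer_gen: "x \<in> S \<Longrightarrow> y ^ n * x \<in> layer y S"
  unfolding layer_def by (rule span_base) blast

lemma layer_base: "x \<in> S \<Longrightarrow> x \<in> layer y S"
  using layer_gen[of x S y 0] by simp

lemma layer_mult: "v \<in> layer y S \<Longrightarrow> y * v \<in> layer y S"
  unfolding layer_def
  by (erule mult_span, rule span_base) (auto simp flip: power_Suc simp: mult.assoc[symmetric], blast)

text \<open>Induction on the power of \<open>y\<close>: each exchange of \<open>z\<close> with
  \<open>y\<close> costs a term in which \<open>w\<close> replaces the product. Stability of the
  layer under \<open>z\<close> thus reduces to the action of \<open>z\<close> on \<open>S\<close>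
  and of the correction \<open>w\<close> on the layer.\<close>

lemma layer_step:
  assumes comm: "z * y = p *s (y * z) + w"
    and z: "\<And>x. x \<in> S \<Longrightarrow> z * x \<in> layer y S"
    and w: "\<And>v. v \<in> layer y S \<Longrightarrow> w * v \<in> layer y S"
    and v: "v \<in> layer y S"
  shows "z * v \<in> layer y S"
proof -
  have *: "z * (y ^ n * x) \<in> layer y S" if "x \<in> S" for n x
  proof (induction n)
    case 0
    then show ?case using z that by simp
  next
    case (Suc n)
    have "z * (y ^ Suc n * x) = p *s (y * (z * (y ^ n * x))) + w * (y ^ n * x)"
      using arg_cong[OF comm, of "\<lambda>u. u * (y ^ n * x)"]
      by (simp add: distrib_right scale_mult_left mult.assoc)
    moreover have "p *s (y * (z * (y ^ n * x))) \<in> layer y S"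
      using layer_mult[OF Suc] unfolding layer_def by (rule span_scale)
    moreover have "w * (y ^ n * x) \<in> layer y S"
      using w layer_gen[OF that] by blast
    ultimately show ?case
      unfolding layer_def by (simp add: span_add)
  qed
  have "v \<in> span {y ^ n * x | n x. x \<in> S}" using v by (simp add: layer_def)
  then have "z * v \<in> span {y ^ n * x | n x. x \<in> S}"
    by (rule mult_span) (use * in \<open>auto simp: layer_def\<close>)
  then show ?thesis by (simp add: layer_def)
qed

lemma layer_commute:
  assumes "z * y = p *s (y * z)"
    and "\<And>x. x \<in> S \<Longrightarrow> z * x \<in> layer y S"
    and "v \<in> layer y S"
  shows "z * v \<in> layer y S"
  using layer_step[of z y p 0] assms by (simp add: layer_def span_zero)

lemma layer_span: "layer y (span B) = span {y ^ n * x | n x. x \<in> B}"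
proof
  have "y ^ n * x \<in> span {y ^ n * x | n x. x \<in> B}" if "x \<in> span B" for n x
    using that by (rule mult_span) (rule span_base, blast)
  then show "layer y (span B) \<subseteq> span {y ^ n * x | n x. x \<in> B}"
    unfolding layer_def by (intro span_minimal) auto
  show "span {y ^ n * x | n x. x \<in> B} \<subseteq> layer y (span B)"
    unfolding layer_def by (rule span_mono) (auto intro: span_base)
qed

end

context root_vectors
begin

abbreviation "L6 \<equiv> span (range (\<lambda>n. a ^ n))"
abbreviation "L5 \<equiv> layer X1112 L6"
abbreviation "L4 \<equiv> layer X112 L5"
abbreviation "L3 \<equiv> layer X11212 L4"
abbreviation "L2 \<equiv> layer X12 L3"
abbreviation "L1 \<equiv> layer b L2"

lemma L1_eq: "L1 = span (range lyndon)"
proof -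
  have "L1 = span {b ^ n * x | n x. x \<in> {X12 ^ n * x | n x. x \<in> {X11212 ^ n * x | n x. x \<in> 
    {X112 ^ n * x | n x. x \<in> {X1112 ^ n * x | n x. x \<in> range (\<lambda>n. a ^ n)}}}}}"
    unfolding layer_span ..
  also have "{b ^ n * x | n x. x \<in> {X12 ^ n * x | n x. x \<in> {X11212 ^ n * x | n x. x \<in> 
    {X112 ^ n * x | n x. x \<in> {X1112 ^ n * x | n x. x \<in> range (\<lambda>n. a ^ n)}}}}} = range lyndon"
    by (auto simp: lyndon_def image_iff mult.assoc split: prod.splits) blast+
  finally show ?thesis .
qed

end

context serre_algebra
begin

text \<open>From the innermost layer outwards, each layer is shown stable first under the root
  vectors that arise as corrections, then under \<open>a\<close>.\<close>

lemma L6_a: "x \<in> L6 \<Longrightarrow> a * x \<in> L6"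
  by (erule mult_span, rule span_base) (auto simp flip: power_Suc)

lemma L5_a: "x \<in> L5 \<Longrightarrow> a * x \<in> L5"
  by (rule layer_commute[OF serre2]) (auto intro: layer_base L6_a)

lemma L4_X1112: "x \<in> L4 \<Longrightarrow> X1112 * x \<in> L4"
  by (rule layer_commute[OF X1112_X112]) (auto intro: layer_base layer_mult)

lemma L4_a: "x \<in> L4 \<Longrightarrow> a * x \<in> L4"
  by (rule layer_step[OF a_X112]) (auto intro: layer_base L5_a L4_X1112)

lemma L3_X112: "x \<in> L3 \<Longrightarrow> X112 * x \<in> L3"
  by (rule layer_commute[OF X112_X11212]) (auto intro: layer_base layer_mult)

lemma L3_a: "x \<in> L3 \<Longrightarrow> a * x \<in> L3"
proof (rule layer_step[OF a_X11212])
  fix v assume "v \<in> L3"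
  then have "X112 * (X112 * v) \<in> L3" by (intro L3_X112)
  then show "(\<tau> *s (X112 * X112)) * v \<in> L3"
    by (simp add: scale_mult_left mult.assoc) (simp add: layer_def span_scale)
qed (auto intro: layer_base L4_a)

lemma L2_X11212: "x \<in> L2 \<Longrightarrow> X11212 * x \<in> L2"
  by (rule layer_commute[OF X11212_X12]) (auto intro: layer_base layer_mult)

lemma L2_X112: "x \<in> L2 \<Longrightarrow> X112 * x \<in> L2"
  by (rule layer_step[OF X112_X12]) (auto intro: layer_base L3_X112 L2_X11212)

lemma L2_a: "x \<in> L2 \<Longrightarrow> a * x \<in> L2"
  by (rule layer_step[OF a_X12]) (auto intro: layer_base L3_a L2_X112)

lemma L1_X12: "x \<in> L1 \<Longrightarrow> X12 * x \<in> L1"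
  by (rule layer_commute[OF serre1]) (auto intro: layer_base layer_mult)

lemma L1_a: "x \<in> L1 \<Longrightarrow> a * x \<in> L1"
  by (rule layer_step[OF a_b]) (auto intro: layer_base L2_a L1_X12)

lemma a_span_lyndon: "x \<in> span (range lyndon) \<Longrightarrow> a * x \<in> span (range lyndon)"
  using L1_a by (simp add: L1_eq)

lemma b_span_lyndon: "x \<in> span (range lyndon) \<Longrightarrow> b * x \<in> span (range lyndon)"
  using layer_mult[of x b L2] by (simp add: L1_eq)

end

section \<open>Endomorphisms of function spaces\<close>

text \<open>
  The product of \<open>endo\<close> is composition in reverse order, so that functions are acted on from the right.
\<close>

typedef (overloaded) ('i, 'k::field) endo =
  "{f :: ('i \<Rightarrow> 'k) \<Rightarrow> ('i \<Rightarrow> 'k).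
     \<forall>p q u v. f (\<lambda>m. p * u m + q * v m) = (\<lambda>m. p * f u m + q * f v m)}"
  morphisms app Endo
  by (rule exI[of _ "\<lambda>u. u"]) simp

setup_lifting type_definition_endo

lemma app_linear: "app f (\<lambda>m. p * u m + q * v m) = (\<lambda>m. p * app f u m + q * app f v m)"
  using app[of f] by blast

instantiation endo :: (type, field) "{ring, monoid_mult}"
begin

lift_definition zero_endo :: "('a, 'b) endo" is "\<lambda>u m. 0" by simp

lift_definition one_endo :: "('a, 'b) endo" is "\<lambda>u. u" by simp

lift_definition plus_endo :: "('a, 'b) endo \<Rightarrow> ('a, 'b) endo \<Rightarrow> ('a, 'b) endo"
  is "\<lambda>f g u m. f u m + g u m" by (simp add: algebra_simps)

lift_definition minus_endo :: "('a, 'b) endo \<Rightarrow> ('a, 'b) endo \<Rightarrow> ('a, 'b) endo"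
  is "\<lambda>f g u m. f u m - g u m" by (simp add: algebra_simps)

lift_definition uminus_endo :: "('a, 'b) endo \<Rightarrow> ('a, 'b) endo"
  is "\<lambda>f u m. - f u m" by (simp add: algebra_simps)

lift_definition times_endo :: "('a, 'b) endo \<Rightarrow> ('a, 'b) endo \<Rightarrow> ('a, 'b) endo"
  is "\<lambda>f g u. g (f u)" by simp

instance
proof
  fix x y z :: "('a, 'b) endo"
  show "x + y + z = x + (y + z)" by transfer (simp add: add.assoc)
  show "x + y = y + x" by transfer (simp add: add.commute)
  show "0 + x = x" by transfer simp
  show "- x + x = 0" by transfer simp
  show "x - y = x + - y" by transfer simp
  show "x * y * z = x * (y * z)" by transfer simp
  show "1 * x = x" by transfer simp
  show "x * 1 = x" by transfer simp
  show "(x + y) * z = x * z + y * z"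
  proof (transfer, intro ext)
    fix f g h :: "('a \<Rightarrow> 'b) \<Rightarrow> 'a \<Rightarrow> 'b" and u m
    assume "\<forall>p q u v. h (\<lambda>m. p * u m + q * v m) = (\<lambda>m. p * h u m + q * h v m)"
    from this[rule_format, of 1 "f u" 1 "g u"]
    show "h (\<lambda>m. f u m + g u m) m = h (f u) m + h (g u) m" by simp
  qed
  show "x * (y + z) = x * y + x * z" by transfer simp
qed

end

lift_definition escale :: "'k::field \<Rightarrow> ('i, 'k) endo \<Rightarrow> ('i, 'k) endo"
  is "\<lambda>c f u m. c * f u m" by (simp add: algebra_simps)

global_interpretation E: algebra_over escale
proof
  fix c d :: "'k::field" and x y :: "('i, 'k) endo"
  show "escale c (x + y) = escale c x + escale c y" by transfer (simp add: algebra_simps)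
  show "escale (c + d) x = escale c x + escale d x" by transfer (simp add: algebra_simps)
  show "escale c (escale d x) = escale (c * d) x" by transfer (simp add: algebra_simps)
  show "escale 1 x = x" by transfer simp
  show "escale c x * y = escale c (x * y)"
  proof (transfer, intro ext)
    fix c :: "'k::field" and f g :: "('i \<Rightarrow> 'k) \<Rightarrow> 'i \<Rightarrow> 'k" and u m
    assume "\<forall>p q u v. g (\<lambda>m. p * u m + q * v m) = (\<lambda>m. p * g u m + q * g v m)"
    from this[rule_format, of c "f u" 0]
    show "g (\<lambda>m. c * f u m) m = c * g (f u) m" by simp
  qed
  show "x * escale c y = escale c (x * y)" by transfer simp
qed

lemmas app_simps = zero_endo.rep_eq one_endo.rep_eq plus_endo.rep_eq minus_endo.rep_eq
  uminus_endo.rep_eq times_endo.rep_eq escale.rep_eq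

lemma endo_eqI: "(\<And>u m. app f u m = app g u m) \<Longrightarrow> f = g"
  by (metis app_inject ext)

section \<open>The free algebra and its evaluation homomorphisms\<close>

lemma single_add_induct [case_names zero add]:
  assumes "P 0" and "\<And>k c p. P p \<Longrightarrow> P (Poly_Mapping.single k c + p)"
  shows "P p"
proof (induction p rule: update_induct)
  case (update f a b)
  then have "Poly_Mapping.update a b f = Poly_Mapping.single a b + f"
    by (intro poly_mapping_eqI)
      (auto simp: lookup_add lookup_single update.rep_eq when_def in_keys_iff)
  with update assms(2) show ?case by simp
qed (rule assms(1))

global_interpretation F: algebra_over fscale
proof
  fix c d :: K and x y :: free_alg
  have comm: "p * Poly_Mapping.single 0 c = Poly_Mapping.single 0 c * p" for p :: free_alg and c
    by (induction p rule: single_add_induct) (simp_all add: mult_single mult.commute distrib_left distrib_right)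
  show "c *\<^sub>F (x + y) = c *\<^sub>F x + c *\<^sub>F y" by (simp add: fscale_def distrib_left)
  show "(c + d) *\<^sub>F x = c *\<^sub>F x + d *\<^sub>F x" by (simp add: fscale_def single_add distrib_right)
  show "c *\<^sub>F d *\<^sub>F x = (c * d) *\<^sub>F x" by (simp add: fscale_def mult_single flip: mult.assoc)
  show "1 *\<^sub>F x = x" by (simp add: fscale_def)
  show "(c *\<^sub>F x) * y = c *\<^sub>F (x * y)" by (simp add: fscale_def mult.assoc)
  show "x * (c *\<^sub>F y) = c *\<^sub>F (x * y)" by (metis fscale_def comm mult.assoc)
qed

context algebra_over
begin

definition word_eval :: "(gen \<Rightarrow> 'a) \<Rightarrow> word \<Rightarrow> 'a"
  where "word_eval g w = prod_list (map g (letters w))"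

lemma word_eval_add: "word_eval g (v + w) = word_eval g v * word_eval g w"
  by (simp add: word_eval_def plus_word_def)

lemma word_eval_0: "word_eval g 0 = 1"
  by (simp add: word_eval_def zero_word_def)

definition free_eval :: "(gen \<Rightarrow> 'a) \<Rightarrow> (word \<Rightarrow>\<^sub>0 'k) \<Rightarrow> 'a"
  where "free_eval g p = (\<Sum>w\<in>Poly_Mapping.keys p. Poly_Mapping.lookup p w *s word_eval g w)"

lemma free_eval_superset:
  assumes "finite A" "Poly_Mapping.keys p \<subseteq> A"
  shows "free_eval g p = (\<Sum>w\<in>A. Poly_Mapping.lookup p w *s word_eval g w)"
  unfolding free_eval_def
  by (rule sum.mono_neutral_left) (use assms in \<open>auto simp: in_keys_iff\<close>)

lemma free_eval_single: "free_eval g (Poly_Mapping.single w c) = c *s word_eval g w"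
  by (subst free_eval_superset[of "{w}"]) (auto simp: lookup_single)

lemma free_eval_0: "free_eval g 0 = 0"
  by (simp add: free_eval_def)

lemma free_eval_add: "free_eval g (p + q) = free_eval g p + free_eval g q"
proof -
  let ?A = "Poly_Mapping.keys p \<union> Poly_Mapping.keys q"
  have "Poly_Mapping.keys (p + q) \<subseteq> ?A" by (rule Poly_Mapping.keys_add)
  then show ?thesis
    by (simp add: free_eval_superset[of ?A] lookup_add scale_left_distrib sum.distrib)
qed

lemma free_eval_uminus: "free_eval g (- p) = - free_eval g p"
  using free_eval_add[of g p "- p"] by (simp add: free_eval_0 eq_neg_iff_add_eq_0 add.commute)

lemma free_eval_diff: "free_eval g (p - q) = free_eval g p - free_eval g q"
  using free_eval_add[of g p "- q"] by (simp add: free_eval_uminus)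

lemma free_eval_mult: "free_eval g (p * q) = free_eval g p * free_eval g q"
proof (induction p rule: single_add_induct)
  case (add v c p)
  have "free_eval g (Poly_Mapping.single v c * q) = c *s word_eval g v * free_eval g q"
    by (induction q rule: single_add_induct)
      (simp_all add: mult_single free_eval_0 free_eval_single word_eval_add scale_mult_left
        scale_mult_right distrib_left free_eval_add)
  with add show ?case by (simp add: distrib_right free_eval_add free_eval_single)
qed (simp add: free_eval_0)

lemma free_eval_1: "free_eval g 1 = 1"
  using free_eval_single[of g 0 1] by (simp add: word_eval_0)

lemma free_eval_power: "free_eval g (p ^ n) = free_eval g p ^ n"
  by (induction n) (simp_all add: free_eval_1 free_eval_mult)

end

context
  fixes scale :: "K \<Rightarrow> 'a::{ring,monoid_mult} \<Rightarrow> 'a"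
  assumes alg: "algebra_over scale"
begin

interpretation algebra_over scale by (rule alg)

lemma free_eval_fgen: "free_eval g (fgen x) = g x"
  by (simp add: fgen_def free_eval_single word_eval_def)

lemma free_eval_fscale: "free_eval g (c *\<^sub>F p) = scale c (free_eval g p)"
  by (simp add: fscale_def free_eval_mult free_eval_single word_eval_0 scale_mult_left)

end

section \<open>Commutation of the Serre elements with the opposite generators\<close>

context root_vectors
begin

definition "S21 = X12 * b - r ^ 3 *s (b * X12)"
definition "S12 = a * X1112 - r ^ 3 *s (X1112 * a)"

text \<open>Left and right multiplication by \<open>a\<close> commute, and \<open>S12\<close> arises
  from \<open>b\<close> by applying left minus t times right for t = s^3, r s^2, r^2 s, r^3. Up to
  sign, the coefficients are the elementary symmetric polynomials of these four scalars.\<close>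

lemma S12_eq: "a ^ 4 * b - ((r + s) * (r ^ 2 + s ^ 2)) *s (a ^ 3 * b * a)
  + (r * s * (r ^ 2 + s ^ 2) * (r ^ 2 + r * s + s ^ 2)) *s (a ^ 2 * b * a ^ 2)
  - ((r * s) ^ 3 * (r + s) * (r ^ 2 + s ^ 2)) *s (a * b * a ^ 3)
  + (r * s) ^ 6 *s (b * a ^ 4) = S12"
  unfolding S12_def X1112_def X112_def X12_def by (simp add: normalize) (simp add: mult_ac flip: scale_left_distrib)

lemma S21_eq:
  assumes "r \<noteq> 0" "s \<noteq> 0"
  shows "b ^ 2 * a - (inverse (r ^ 3) + inverse (s ^ 3)) *s (b * a * b)
    + inverse ((r * s) ^ 3) *s (a * b ^ 2) = inverse ((r * s) ^ 3) *s S21"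
proof (rule scale_cancel)
  show "(r * s) ^ 3 \<noteq> 0" using assms by simp
  have *: "(r * s) ^ 3 * (inverse (r ^ 3) + inverse (s ^ 3)) = r ^ 3 + s ^ 3"
    "(r * s) ^ 3 * inverse ((r * s) ^ 3) = 1"
    using assms by (simp_all add: field_simps)
  have "(r * s) ^ 3 *s (b ^ 2 * a) - (r ^ 3 + s ^ 3) *s (b * a * b) + 1 *s (a * b ^ 2) = 1 *s S21"
    unfolding S21_def X12_def by (simp add: normalize)
  then show "(r * s) ^ 3 *s (b ^ 2 * a - (inverse (r ^ 3) + inverse (s ^ 3)) *s (b * a * b)
      + inverse ((r * s) ^ 3) *s (a * b ^ 2)) = (r * s) ^ 3 *s (inverse ((r * s) ^ 3) *s S21)"
    unfolding scale_right_diff_distrib scale_right_distrib scale_scale * by simp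
qed

text \<open>All products are reversed, because the Serre relations for the \<open>f\<close>
  generators are those for the \<open>e\<close> generators read backwards.\<close>

definition "Y12 = b * a - s ^ 3 *s (a * b)"
definition "Y112 = Y12 * a - (r * s ^ 2) *s (a * Y12)"
definition "Y1112 = Y112 * a - (r ^ 2 * s) *s (a * Y112)"
definition "SY21 = b * Y12 - r ^ 3 *s (Y12 * b)"
definition "SY12 = Y1112 * a - r ^ 3 *s (a * Y1112)"

lemma SY12_eq: "b * a ^ 4 - ((r + s) * (r ^ 2 + s ^ 2)) *s (a * b * a ^ 3)
  + (r * s * (r ^ 2 + s ^ 2) * (r ^ 2 + r * s + s ^ 2)) *s (a ^ 2 * b * a ^ 2)
  - ((r * s) ^ 3 * (r + s) * (r ^ 2 + s ^ 2)) *s (a ^ 3 * b * a)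
  + (r * s) ^ 6 *s (a ^ 4 * b) = SY12"
  unfolding SY12_def Y1112_def Y112_def Y12_def by (simp add: normalize) (simp add: mult_ac flip: scale_left_distrib)

lemma SY21_eq:
  assumes "r \<noteq> 0" "s \<noteq> 0"
  shows "a * b ^ 2 - (inverse (r ^ 3) + inverse (s ^ 3)) *s (b * a * b)
    + inverse ((r * s) ^ 3) *s (b ^ 2 * a) = inverse ((r * s) ^ 3) *s SY21"
proof (rule scale_cancel)
  show "(r * s) ^ 3 \<noteq> 0" using assms by simp
  have *: "(r * s) ^ 3 * (inverse (r ^ 3) + inverse (s ^ 3)) = r ^ 3 + s ^ 3"
    "(r * s) ^ 3 * inverse ((r * s) ^ 3) = 1"
    using assms by (simp_all add: field_simps)
  have "(r * s) ^ 3 *s (a * b ^ 2) - (r ^ 3 + s ^ 3) *s (b * a * b) + 1 *s (b ^ 2 * a) = 1 *s SY21"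
    unfolding SY21_def Y12_def by (simp add: normalize)
  then show "(r * s) ^ 3 *s (a * b ^ 2 - (inverse (r ^ 3) + inverse (s ^ 3)) *s (b * a * b)
      + inverse ((r * s) ^ 3) *s (b ^ 2 * a)) = (r * s) ^ 3 *s (inverse ((r * s) ^ 3) *s SY21)"
    unfolding scale_right_diff_distrib scale_right_distrib scale_scale * by simp
qed

end

text \<open>
  Here \<open>a, b\<close> stand for \<open>e\<^sub>1, e\<^sub>2\<close>, \<open>c, d\<close> for \<open>f\<^sub>1, f\<^sub>2\<close>, \<open>w1, w2\<close> for \<open>\<omega>\<^sub>1, \<omega>\<^sub>2\<close> and \<open>v1, v2\<close> for \<open>\<omega>\<^sub>1', \<omega>\<^sub>2'\<close>.
  The inverses of \<open>r, s\<close> are variables \<open>ri, si\<close> because then the simplifier's ordering of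
  products puts \<open>r\<close> next to \<open>ri\<close> and \<open>s\<close> next to \<open>si\<close>, so that they cancel.
\<close>

locale double_algebra = algebra_over scale
  for scale :: "'k::field \<Rightarrow> 'a::{ring,monoid_mult} \<Rightarrow> 'a" (infixr "*s" 75) +
  fixes r ri s si k1 k2 :: 'k and a b c d w1 w2 v1 v2 :: 'a
  assumes r_ri: "r * ri = 1" and s_si: "s * si = 1"
    and w1_a: "w1 * a = (r * si) *s (a * w1)"
    and w1_b: "w1 * b = s ^ 3 *s (b * w1)"
    and w2_a: "w2 * a = ri ^ 3 *s (a * w2)"
    and w2_b: "w2 * b = (r ^ 3 * si ^ 3) *s (b * w2)"
    and v1_a: "v1 * a = (ri * s) *s (a * v1)"
    and v1_b: "v1 * b = r ^ 3 *s (b * v1)"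
    and v2_a: "v2 * a = si ^ 3 *s (a * v2)"
    and v2_b: "v2 * b = (ri ^ 3 * s ^ 3) *s (b * v2)"
    and w1_c: "w1 * c = (ri * s) *s (c * w1)"
    and w1_d: "w1 * d = si ^ 3 *s (d * w1)"
    and w2_c: "w2 * c = r ^ 3 *s (c * w2)"
    and w2_d: "w2 * d = (ri ^ 3 * s ^ 3) *s (d * w2)"
    and v1_c: "v1 * c = (r * si) *s (c * v1)"
    and v1_d: "v1 * d = ri ^ 3 *s (d * v1)"
    and v2_c: "v2 * c = s ^ 3 *s (c * v2)"
    and v2_d: "v2 * d = (r ^ 3 * si ^ 3) *s (d * v2)"
    and a_c: "a * c = c * a + k1 *s w1 - k1 *s v1"
    and b_d: "b * d = d * b + k2 *s w2 - k2 *s v2"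
    and a_d: "a * d = d * a"
    and b_c: "b * c = c * b"
begin

sublocale e: root_vectors scale r s a b ..
sublocale f: root_vectors scale r s c d ..

lemma r_ri': "r * (ri * x) = x" and s_si': "s * (si * x) = x"
  by (simp_all add: r_ri s_si flip: mult.assoc)

lemmas inv_rules = r_ri s_si r_ri' s_si'

lemmas torus_rules = w1_a w1_b w2_a w2_b v1_a v1_b v2_a v2_b
  w1_c w1_d w2_c w2_d v1_c v1_d v2_c v2_d
lemmas ef_rules = a_c b_d a_d b_c
lemmas rules = torus_rules ef_rules
lemmas all_rules = rules rules[THEN left_rule] inv_rules normalize

lemma X12_torus:
  "w1 * e.X12 = (r * s ^ 2) *s (e.X12 * w1)" "v1 * e.X12 = (r ^ 2 * s) *s (e.X12 * v1)"
  "w2 * e.X12 = si ^ 3 *s (e.X12 * w2)" "v2 * e.X12 = ri ^ 3 *s (e.X12 * v2)"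
  unfolding e.X12_def by (simp_all add: all_rules)

lemma X112_torus:
  "w1 * e.X112 = (r ^ 2 * s) *s (e.X112 * w1)" "v1 * e.X112 = (r * s ^ 2) *s (e.X112 * v1)"
  "w2 * e.X112 = (ri ^ 3 * si ^ 3) *s (e.X112 * w2)" "v2 * e.X112 = (ri ^ 3 * si ^ 3) *s (e.X112 * v2)"
  unfolding e.X112_def by (simp_all add: X12_torus X12_torus[THEN left_rule] all_rules)

lemma X1112_torus:
  "w1 * e.X1112 = r ^ 3 *s (e.X1112 * w1)" "v1 * e.X1112 = s ^ 3 *s (e.X1112 * v1)"
  "w2 * e.X1112 = (ri ^ 6 * si ^ 3) *s (e.X1112 * w2)" "v2 * e.X1112 = (ri ^ 3 * si ^ 6) *s (e.X1112 * v2)"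
  unfolding e.X1112_def by (simp_all add: X112_torus X112_torus[THEN left_rule] all_rules)

lemma S12_torus:
  "\<exists>q. w1 * e.S12 = q *s (e.S12 * w1)" "\<exists>q. v1 * e.S12 = q *s (e.S12 * v1)"
  "\<exists>q. w2 * e.S12 = q *s (e.S12 * w2)" "\<exists>q. v2 * e.S12 = q *s (e.S12 * v2)"
proof -
  have "w1 * e.S12 = (r ^ 4 * si) *s (e.S12 * w1)" "v1 * e.S12 = (ri * s ^ 4) *s (e.S12 * v1)"
    "w2 * e.S12 = (ri ^ 9 * si ^ 3) *s (e.S12 * w2)" "v2 * e.S12 = (ri ^ 3 * si ^ 9) *s (e.S12 * v2)"
    unfolding e.S12_def by (simp_all add: X1112_torus X1112_torus[THEN left_rule] all_rules)
  then show "\<exists>q. w1 * e.S12 = q *s (e.S12 * w1)" "\<exists>q. v1 * e.S12 = q *s (e.S12 * v1)"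
    "\<exists>q. w2 * e.S12 = q *s (e.S12 * w2)" "\<exists>q. v2 * e.S12 = q *s (e.S12 * v2)"
    by blast+
qed

lemma S21_torus:
  "\<exists>q. w1 * e.S21 = q *s (e.S21 * w1)" "\<exists>q. v1 * e.S21 = q *s (e.S21 * v1)"
  "\<exists>q. w2 * e.S21 = q *s (e.S21 * w2)" "\<exists>q. v2 * e.S21 = q *s (e.S21 * v2)"
proof -
  have "w1 * e.S21 = (r * s ^ 5) *s (e.S21 * w1)" "v1 * e.S21 = (r ^ 5 * s) *s (e.S21 * v1)"
    "w2 * e.S21 = (r ^ 3 * si ^ 6) *s (e.S21 * w2)" "v2 * e.S21 = (ri ^ 6 * s ^ 3) *s (e.S21 * v2)"
    unfolding e.S21_def by (simp_all add: X12_torus X12_torus[THEN left_rule] all_rules)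
  then show "\<exists>q. w1 * e.S21 = q *s (e.S21 * w1)" "\<exists>q. v1 * e.S21 = q *s (e.S21 * v1)"
    "\<exists>q. w2 * e.S21 = q *s (e.S21 * w2)" "\<exists>q. v2 * e.S21 = q *s (e.S21 * v2)"
    by blast+
qed

text \<open>The scalars of the brackets make all \<open>w1\<close> terms cancel, and the surviving
  \<open>v1\<close> term carries the preceding root vector: \<open>b\<close>, \<open>X12\<close>,
  \<open>X112\<close>. One step further, in \<open>S12_c\<close>, its coefficient is zero.\<close>

lemma X12_c: "e.X12 * c = c * e.X12 - (k1 * (r ^ 3 - s ^ 3)) *s (b * v1)"
  unfolding e.X12_def by (simp add: all_rules)

lemma X112_c: "e.X112 * c = c * e.X112 - (k1 * (r ^ 3 - s ^ 3 + r ^ 2 * s - r * s ^ 2)) *s (e.X12 * v1)"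
  unfolding e.X112_def
  by (simp add: X12_c X12_c[THEN left_rule] X12_torus e.a_b[THEN left_rule] all_rules)

lemma X1112_c: "e.X1112 * c = c * e.X1112 - (k1 * (r ^ 3 - s ^ 3)) *s (e.X112 * v1)"
  unfolding e.X1112_def
  by (simp add: X112_c X112_c[THEN left_rule] X112_torus e.a_X12[THEN left_rule] all_rules)

lemma S12_c: "e.S12 * c = c * e.S12"
  unfolding e.S12_def
  by (simp add: X1112_c X1112_c[THEN left_rule] X1112_torus e.a_X112[THEN left_rule] all_rules)

text \<open>Only \<open>w2\<close> terms survive, and successive brackets multiply their coefficient
  by 1 - (s/r)^k for k = 3, 2, 1. The last bracket has k = 0, whence \<open>S12_d\<close>.\<close>

lemma X12_d: "e.X12 * d = d * e.X12 + (k2 * (1 - ri ^ 3 * s ^ 3)) *s (a * w2)"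
  unfolding e.X12_def by (simp add: all_rules)

lemma X112_d: "e.X112 * d = d * e.X112
  + (k2 * (1 - ri ^ 3 * s ^ 3) * (1 - ri ^ 2 * s ^ 2)) *s (a * (a * w2))"
  unfolding e.X112_def by (simp add: X12_d X12_d[THEN left_rule] all_rules)

lemma X1112_d: "e.X1112 * d = d * e.X1112
  + (k2 * (1 - ri ^ 3 * s ^ 3) * (1 - ri ^ 2 * s ^ 2) * (1 - ri * s)) *s (a * (a * (a * w2)))"
  unfolding e.X1112_def by (simp add: X112_d X112_d[THEN left_rule] all_rules)

lemma S12_d: "e.S12 * d = d * e.S12"
  unfolding e.S12_def by (simp add: X1112_d X1112_d[THEN left_rule] all_rules)

lemma S21_c: "e.S21 * c = c * e.S21"
  unfolding e.S21_def
  by (simp add: X12_c X12_c[THEN left_rule] X12_torus all_rules)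

lemma S21_d: "e.S21 * d = d * e.S21"
  unfolding e.S21_def
  by (simp add: X12_d X12_d[THEN left_rule] X12_torus e.a_b[THEN left_rule] e.a_b all_rules)

lemma Y12_torus:
  "w1 * f.Y12 = (ri * si ^ 2) *s (f.Y12 * w1)" "v1 * f.Y12 = (ri ^ 2 * si) *s (f.Y12 * v1)"
  "w2 * f.Y12 = s ^ 3 *s (f.Y12 * w2)" "v2 * f.Y12 = r ^ 3 *s (f.Y12 * v2)"
  unfolding f.Y12_def by (simp_all add: all_rules)

lemma Y112_torus:
  "w1 * f.Y112 = (ri ^ 2 * si) *s (f.Y112 * w1)" "v1 * f.Y112 = (ri * si ^ 2) *s (f.Y112 * v1)"
  unfolding f.Y112_def by (simp_all add: Y12_torus Y12_torus[THEN left_rule] all_rules)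

lemma Y1112_torus:
  "w1 * f.Y1112 = ri ^ 3 *s (f.Y1112 * w1)" "v1 * f.Y1112 = si ^ 3 *s (f.Y1112 * v1)"
  unfolding f.Y1112_def by (simp_all add: Y112_torus Y112_torus[THEN left_rule] all_rules)


lemma d_c: "d * c = s ^ 3 *s (c * d) + f.Y12"
  and Y12_c: "f.Y12 * c = (r * s ^ 2) *s (c * f.Y12) + f.Y112"
  and Y112_c: "f.Y112 * c = (r ^ 2 * s) *s (c * f.Y112) + f.Y1112"
  by (simp_all add: f.Y12_def f.Y112_def f.Y1112_def)

text \<open>The same cancellations for the reversed vectors end in \<open>a_SY12\<close>,
  \<open>b_SY12\<close>, \<open>a_SY21\<close>, \<open>b_SY21\<close>. Combined with
  \<open>eq_0_if_commutes_tE\<close> these give the Serre relations for the \<open>tF\<close>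
  operators.\<close>

lemma a_Y12: "a * f.Y12 = f.Y12 * a - (k1 * (1 - ri ^ 3 * s ^ 3)) *s (d * v1)"
  unfolding f.Y12_def by (simp add: all_rules)

lemma a_Y112: "a * f.Y112 = f.Y112 * a
  - (k1 * ((1 - ri ^ 3 * s ^ 3) * r * si + 1 - ri * s)) *s (f.Y12 * v1)"
  unfolding f.Y112_def
  by (simp add: a_Y12 a_Y12[THEN left_rule] Y12_torus d_c[THEN left_rule] all_rules)

lemma a_Y1112: "a * f.Y1112 = f.Y1112 * a - (k1 * (r ^ 2 * si ^ 2 - ri * s)) *s (f.Y112 * v1)"
  unfolding f.Y1112_def
  by (simp add: a_Y112 a_Y112[THEN left_rule] Y112_torus Y12_c[THEN left_rule] all_rules)

lemma a_SY12: "a * f.SY12 = f.SY12 * a"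
  unfolding f.SY12_def
  by (simp add: a_Y1112 a_Y1112[THEN left_rule] Y1112_torus Y112_c[THEN left_rule] all_rules)

lemma b_Y12: "b * f.Y12 = f.Y12 * b + (k2 * (r ^ 3 - s ^ 3)) *s (c * w2)"
  unfolding f.Y12_def by (simp add: all_rules)

lemma b_Y112: "b * f.Y112 = f.Y112 * b + (k2 * (r ^ 3 - s ^ 3) * (r ^ 3 - r * s ^ 2)) *s (c * (c * w2))"
  unfolding f.Y112_def by (simp add: b_Y12 b_Y12[THEN left_rule] all_rules)

lemma b_Y1112: "b * f.Y1112 = f.Y1112 * b
  + (k2 * (r ^ 3 - s ^ 3) * (r ^ 3 - r * s ^ 2) * (r ^ 3 - r ^ 2 * s)) *s (c * (c * (c * w2)))"
  unfolding f.Y1112_def by (simp add: b_Y112 b_Y112[THEN left_rule] all_rules)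

lemma b_SY12: "b * f.SY12 = f.SY12 * b"
  unfolding f.SY12_def by (simp add: b_Y1112 b_Y1112[THEN left_rule] all_rules)

lemma a_SY21: "a * f.SY21 = f.SY21 * a"
  unfolding f.SY21_def by (simp add: a_Y12 a_Y12[THEN left_rule] all_rules)

lemma b_SY21: "b * f.SY21 = f.SY21 * b"
  unfolding f.SY21_def
  by (simp add: b_Y12 b_Y12[THEN left_rule] Y12_torus Y12_torus[THEN left_rule] d_c d_c[THEN left_rule] all_rules)

end

section \<open>A representation on functions of words\<close>

lemma rr_nz [simp]: "rr \<noteq> 0" and ss_nz [simp]: "ss \<noteq> 0"
  by (simp_all add: rr_def ss_def Zero_fract_def eq_fract)

lemma pairing_nz [simp]: "pairing i j \<noteq> 0"
  by (cases i; cases j) simp_all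

text \<open>The eigenvalues of \<open>\<omega>\<^sub>i\<close> and, in \<open>\<chi>'\<close>, of
  \<open>\<omega>\<^sub>i'\<close> on a word in the Verma module.\<close>

definition \<chi> :: "idx \<Rightarrow> idx list \<Rightarrow> K"
  where "\<chi> i w = prod_list (map (\<lambda>j. pairing j i) w)"

definition \<chi>' :: "idx \<Rightarrow> idx list \<Rightarrow> K"
  where "\<chi>' i w = prod_list (map (\<lambda>j. inverse (pairing i j)) w)"

lemma chi_Cons: "\<chi> i (j # w) = pairing j i * \<chi> i w" "\<chi>' i (j # w) = inverse (pairing i j) * \<chi>' i w"
  by (simp_all add: \<chi>_def \<chi>'_def)

lemma chi_nz [simp]: "\<chi> i w \<noteq> 0" "\<chi>' i w \<noteq> 0"
  by (auto simp: \<chi>_def \<chi>'_def prod_list_zero_iff simp del: pairing.simps)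

text \<open>
  The transpose of the action of \<open>f\<^sub>i\<close> on the free algebra in \<open>e\<^sub>1, e\<^sub>2\<close>, viewed as the lowest weight
  Verma module (without Serre relations) whose lowest weight vector, the empty word, is fixed by
  all \<open>\<omega>\<^sub>j, \<omega>\<^sub>j'\<close>.
\<close>

primrec f_act :: "idx \<Rightarrow> (idx list \<Rightarrow> K) \<Rightarrow> idx list \<Rightarrow> K" where
  "f_act i u [] = 0"
| "f_act i u (j # w) = f_act i (\<lambda>v. u (j # v)) w
     - (if i = j then inverse (r_of i - s_of i) * ((\<chi> i w - \<chi>' i w) * u w) else 0)"

declare f_act.simps(2) [simp del]
lemmas f_act_Cons = f_act.simps(2)

lemma f_act_linear: "f_act i (\<lambda>w. p * u w + q * v w) w = p * f_act i u w + q * f_act i v w"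
  by (induction w arbitrary: u v) (simp_all add: f_act_Cons algebra_simps)

text \<open>\<open>f_act i\<close> reads \<open>u\<close> at words with one letter \<open>i\<close>
  removed, and each removal divides the multiplicative character \<open>c\<close> by
  \<open>p i\<close>.\<close>

lemma f_act_character:
  assumes c: "\<And>j w. c (j # w) = p j * c w" and p: "p i \<noteq> 0"
  shows "f_act i (\<lambda>w. c w * u w) w = inverse (p i) * (c w * f_act i u w)"
proof (induction w arbitrary: u)
  case Nil
  then show ?case by simp
next
  case (Cons j w)
  have "f_act i (\<lambda>v. c (j # v) * u (j # v)) w = p j * f_act i (\<lambda>v. c v * u (j # v)) w"
    using f_act_linear[of i "p j" "\<lambda>v. c v * u (j # v)" 0 "\<lambda>_. 0" w] by (simp add: c mult.assoc)
  also have "\<dots> = inverse (p i) * (c (j # w) * f_act i (\<lambda>v. u (j # v)) w)"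
    by (simp add: Cons c)
  finally have *: "f_act i (\<lambda>v. c (j # v) * u (j # v)) w = inverse (p i) * (c (j # w) * f_act i (\<lambda>v. u (j # v)) w)" .
  show ?case
  proof (cases "i = j")
    case True
    have cancel: "inverse (p j) * (c (j # w) * z) = c w * z" for z
      using p True by (simp add: c)
    show ?thesis
      using * unfolding f_act_Cons True cancel by (simp add: algebra_simps)
  next
    case False
    then show ?thesis using * by (simp add: f_act_Cons)
  qed
qed

lift_definition shift :: "('i \<Rightarrow> 'i) \<Rightarrow> ('i, 'k::field) endo" is "\<lambda>g u w. u (g w)" by simp

definition tE :: "idx \<Rightarrow> (idx list, K) endo" where "tE i = shift (Cons i)"

definition tF :: "idx \<Rightarrow> (idx list, K) endo" where "tF i = Endo (f_act i)"

lemma app_tE: "app (tE i) u = (\<lambda>w. u (i # w))"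
  by (simp add: tE_def shift.rep_eq)

lemma app_tF: "app (tF i) = f_act i"
  unfolding tF_def by (rule Endo_inverse) (simp add: f_act_linear fun_eq_iff)

lift_definition diag :: "('i \<Rightarrow> 'k::field) \<Rightarrow> ('i, 'k) endo" is "\<lambda>c u w. c w * u w"
  by (simp add: algebra_simps)

abbreviation "tW i \<equiv> diag (\<chi> i)"
abbreviation "tV i \<equiv> diag (\<chi>' i)"

primrec tgen :: "gen \<Rightarrow> (idx list, K) endo" where
  "tgen (Ge i) = tE i"
| "tgen (Gf i) = tF i"
| "tgen (Gom i) = tW i"
| "tgen (Gominv i) = diag (\<lambda>w. inverse (\<chi> i w))"
| "tgen (Gom' i) = tV i"
| "tgen (Gominv' i) = diag (\<lambda>w. inverse (\<chi>' i w))"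

lemmas op_simps = app_simps app_tE app_tF diag.rep_eq

lemma tW_tE: "tW j * tE i = escale (pairing i j) (tE i * tW j)"
  by (rule endo_eqI) (simp add: op_simps chi_Cons mult.assoc)

lemma tV_tE: "tV j * tE i = escale (inverse (pairing j i)) (tE i * tV j)"
  by (rule endo_eqI) (simp add: op_simps chi_Cons mult.assoc)

lemma tW_tF: "tW j * tF i = escale (inverse (pairing i j)) (tF i * tW j)"
  by (rule endo_eqI) (simp add: op_simps f_act_character[of "\<chi> j" "\<lambda>i. pairing i j"] chi_Cons)

lemma tV_tF: "tV j * tF i = escale (pairing j i) (tF i * tV j)"
  by (rule endo_eqI) (simp add: op_simps f_act_character[of "\<chi>' j" "\<lambda>i. inverse (pairing j i)"] chi_Cons)

lemma tE_tF: "tE i * tF j = tF j * tE i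
  + (if i = j then escale (inverse (r_of i - s_of i)) (tW i - tV i) else 0)"
  by (rule endo_eqI) (simp add: op_simps f_act_Cons algebra_simps)

text \<open>With the reversed product of \<open>endo\<close>, the transposed operators satisfy the
  torus and \<open>ef\<close> relations in their original order. The Serre relations for
  \<open>e\<close> are absent since words are free.\<close>

global_interpretation T: double_algebra escale rr "inverse rr" ss "inverse ss"
  "inverse (rr - ss)" "inverse (rr ^ 3 - ss ^ 3)"
  "tE I1" "tE I2" "tF I1" "tF I2" "tW I1" "tW I2" "tV I1" "tV I2"
  by unfold_locales
    (simp_all add: tW_tE tV_tE tW_tF tV_tF tE_tF power_inverse E.scale_right_diff_distrib mult.commute)

text \<open>Dual to the fact that the empty word generates the Verma module: commuting with
  \<open>tE i\<close> strips the first letter of the argument until the empty word is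
  reached.\<close>

lemma eq_0_if_commutes_tE:
  assumes "\<And>i. tE i * Z = Z * tE i" "\<And>u. app Z u [] = 0"
  shows "Z = 0"
proof (rule endo_eqI)
  fix u w
  show "app Z u w = app 0 u w"
  proof (induction w arbitrary: u)
    case Nil
    then show ?case by (simp add: assms op_simps)
  next
    case (Cons i w)
    have "app Z u (i # w) = app (Z * tE i) u w" by (simp add: op_simps)
    also have "\<dots> = app Z (app (tE i) u) w" unfolding assms(1)[symmetric] by (simp add: op_simps)
    finally show ?case by (simp add: Cons op_simps)
  qed
qed

lemma SY12_eq_0: "T.f.SY12 = 0" and SY21_eq_0: "T.f.SY21 = 0"
proof -
  show "T.f.SY12 = 0"
  proof (rule eq_0_if_commutes_tE)
    show "tE i * T.f.SY12 = T.f.SY12 * tE i" for i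
      by (cases i) (simp_all add: T.a_SY12 T.b_SY12)
  qed (simp add: T.f.SY12_def T.f.Y1112_def T.f.Y112_def T.f.Y12_def op_simps)
  show "T.f.SY21 = 0"
  proof (rule eq_0_if_commutes_tE)
    show "tE i * T.f.SY21 = T.f.SY21 * tE i" for i
      by (cases i) (simp_all add: T.a_SY21 T.b_SY21)
  qed (simp add: T.f.SY21_def T.f.Y12_def op_simps)
qed

section \<open>Functionals vanishing on the ideal of the Serre elements\<close>

definition tEs :: "idx list \<Rightarrow> (idx list, K) endo" where "tEs p = prod_list (map tE p)"

lemma tEs_simps [simp]: "tEs [] = 1" "tEs (i # p) = tE i * tEs p"
  by (simp_all add: tEs_def)

text \<open>The functionals that vanish on \<open>p Z w\<close> for all words \<open>p, w\<close> in \<open>e\<^sub>1, e\<^sub>2\<close>.\<close>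

definition annih :: "(idx list, K) endo \<Rightarrow> (idx list \<Rightarrow> K) set"
  where "annih Z = {u. \<forall>p. app (tEs p * Z) u = (\<lambda>_. 0)}"

lemma annih_linear:
  "u \<in> annih Z \<Longrightarrow> v \<in> annih Z \<Longrightarrow> (\<lambda>m. p * u m + q * v m) \<in> annih Z"
  by (simp add: annih_def app_linear)

lemma app_0: "app f (\<lambda>_. 0) = (\<lambda>_. 0)"
  using app_linear[of f 0 "\<lambda>_. 0" 0 "\<lambda>_. 0"] by simp

lemma annih_0: "(\<lambda>_. 0) \<in> annih Z"
  by (simp add: annih_def app_0)

lemma annih_tE: "u \<in> annih Z \<Longrightarrow> app (tE i) u \<in> annih Z"
proof -
  assume "u \<in> annih Z"
  then have "app (tEs (i # p) * Z) u = (\<lambda>_. 0)" for p unfolding annih_def by blast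
  then show ?thesis by (simp add: annih_def app_simps mult.assoc)
qed

lemma annih_torus:
  assumes D: "\<And>i. \<exists>c. D * tE i = escale c (tE i * D)" and Z: "\<exists>q. D * Z = escale q (Z * D)"
    and u: "u \<in> annih Z"
  shows "app D u \<in> annih Z"
proof -
  have "\<exists>c. D * tEs p = escale c (tEs p * D)" for p
  proof (induction p)
    case Nil
    show ?case by (rule exI[of _ 1]) (simp)
  next
    case (Cons i p)
    then obtain c where c: "D * tEs p = escale c (tEs p * D)" by blast
    obtain c' where c': "D * tE i = escale c' (tE i * D)" using D by blast
    have "D * tEs (i # p) = D * tE i * tEs p" by (simp add: mult.assoc)
    also have "\<dots> = escale (c' * c) (tEs (i # p) * D)"
      by (simp add: c' c E.scale_mult_left E.scale_mult_right mult.assoc)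
    finally show ?case by blast
  qed
  then obtain c where c: "D * tEs p = escale (c p) (tEs p * D)" for p by metis
  obtain q where q: "D * Z = escale q (Z * D)" using Z by blast
  have "app (tEs p * Z) (app D u) = (\<lambda>_. 0)" for p
  proof -
    have "D * (tEs p * Z) = escale (c p * q) (tEs p * Z * D)"
      by (simp add: c[THEN E.left_rule] q E.scale_mult_left E.scale_mult_right mult.assoc)
    moreover have "app (tEs p * Z) u = (\<lambda>_. 0)" using u by (simp add: annih_def)
    ultimately have "app (D * (tEs p * Z)) u = (\<lambda>_. 0)"
      by (simp add: app_simps app_0)
    then show ?thesis by (simp add: op_simps)
  qed
  then show ?thesis by (simp add: annih_def)
qed

lemma inverse_commutes:
  fixes D D' Z :: "('i, 'k::field) endo"
  assumes "D * D' = 1" "D' * D = 1" "\<exists>q. D * Z = escale q (Z * D)"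
  shows "\<exists>q. D' * Z = escale q (Z * D')"
proof -
  obtain q where q: "D * Z = escale q (Z * D)" using assms by blast
  have "Z * D' = D' * (D * Z) * D'" by (simp add: assms flip: mult.assoc)
  also have "\<dots> = escale q (D' * Z * (D * D'))"
    by (simp add: q E.scale_mult_left E.scale_mult_right mult.assoc)
  finally have *: "Z * D' = escale q (D' * Z)" by (simp add: assms)
  show ?thesis
  proof (cases "q = 0")
    case True
    then have "Z * D' * D = 0" by (simp add: *)
    then have "Z = 0" by (simp add: mult.assoc assms)
    then show ?thesis by simp
  next
    case False
    then have "D' * Z = escale (inverse q) (Z * D')" by (simp add: *)
    then show ?thesis by blast
  qed
qed

text \<open>Moving \<open>tF j\<close> through \<open>tE i\<close> leaves a multiple of
  \<open>tW j - tV j\<close>, which preserves \<open>annih Z\<close>. Once the word \<open>p\<close>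
  is used up, \<open>Z\<close> itself commutes with \<open>tF j\<close>.\<close>

lemma annih_tF:
  assumes torus: "\<And>u. u \<in> annih Z \<Longrightarrow> app (tW j) u \<in> annih Z" "\<And>u. u \<in> annih Z \<Longrightarrow> app (tV j) u \<in> annih Z"
    and Z: "Z * tF j = tF j * Z" and u: "u \<in> annih Z"
  shows "app (tF j) u \<in> annih Z"
proof -
  have "app (tEs p * Z) (app (tF j) u) = (\<lambda>_. 0)" if "u \<in> annih Z" for p u
    using that
  proof (induction p arbitrary: u)
    case Nil
    then have "app (tEs [] * Z) u = (\<lambda>_. 0)" unfolding annih_def by blast
    then have "app (Z * tF j) u = (\<lambda>_. 0)" by (simp add: app_simps app_0)
    then show ?case unfolding Z by (simp add: app_simps)
  next
    case (Cons i p)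
    define k where "k = (if i = j then inverse (r_of i - s_of i) else 0)"
    have *: "tF j * tE i = tE i * tF j - escale k (tW j - tV j)"
      by (simp add: tE_tF k_def)
    let ?v = "\<lambda>w. 1 * app (tW j) u w + (-1) * app (tV j) u w"
    have "app (tE i) (app (tF j) u) = app (tF j * tE i) u" by (simp add: op_simps)
    also have "\<dots> = (\<lambda>w. 1 * app (tF j) (app (tE i) u) w + (-k) * ?v w)"
      unfolding * by (simp add: op_simps algebra_simps)
    finally have "app (tE i) (app (tF j) u) = (\<lambda>w. 1 * app (tF j) (app (tE i) u) w + (-k) * ?v w)" .
    moreover have "app (tEs p * Z) (app (tF j) (app (tE i) u)) = (\<lambda>_. 0)"
      by (rule Cons.IH[OF annih_tE[OF Cons.prems]])
    moreover have "app (tEs p * Z) ?v = (\<lambda>_. 0)"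
      using annih_linear[OF torus(1)[OF Cons.prems] torus(2)[OF Cons.prems], of 1 "-1"] unfolding annih_def by blast
    ultimately have "app (tEs p * Z) (app (tE i) (app (tF j) u)) = (\<lambda>_. 0)"
      by (simp only: app_linear) simp
    then show ?case by (simp add: app_simps)
  qed
  then show ?thesis using u by (simp add: annih_def)
qed

definition "teval = E.free_eval tgen"

lemma tgen_inverse:
  "tgen (Gom i) * tgen (Gominv i) = 1" "tgen (Gominv i) * tgen (Gom i) = 1"
  "tgen (Gom' i) * tgen (Gominv' i) = 1" "tgen (Gominv' i) * tgen (Gom' i) = 1"
  by (rule endo_eqI, simp add: op_simps)+

lemma torus_tE_ex: "\<exists>c. tgen (Gom j) * tE i = escale c (tE i * tgen (Gom j))"
  "\<exists>c. tgen (Gom' j) * tE i = escale c (tE i * tgen (Gom' j))"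
  unfolding tgen.simps by (rule exI, rule tW_tE, rule exI, rule tV_tE)

text \<open>Dual to the statement that the two-sided ideal generated by such a \<open>Z\<close> is a
  submodule of the Verma module. The hypotheses are what \<open>S12_torus\<close>,
  \<open>S12_c\<close>, \<open>S12_d\<close> and their \<open>S21\<close> analogues provide.\<close>

lemma annih_teval:
  assumes ZW: "\<And>j. \<exists>q. tW j * Z = escale q (Z * tW j)" and ZV: "\<And>j. \<exists>q. tV j * Z = escale q (Z * tV j)"
    and ZF: "\<And>j. Z * tF j = tF j * Z" and u: "u \<in> annih Z"
  shows "app (teval x) u \<in> annih Z"
proof -
  note ZW' = ZW[folded tgen.simps] and ZV' = ZV[folded tgen.simps]
  have W: "app (tgen (Gom i)) v \<in> annih Z" if "v \<in> annih Z" for i v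
    by (rule annih_torus[OF torus_tE_ex(1) ZW' that])
  have V: "app (tgen (Gom' i)) v \<in> annih Z" if "v \<in> annih Z" for i v
    by (rule annih_torus[OF torus_tE_ex(2) ZV' that])
  have Wi: "app (tgen (Gominv i)) v \<in> annih Z" if "v \<in> annih Z" for i v
    by (rule annih_torus[OF inverse_commutes[OF tgen_inverse(1,2) torus_tE_ex(1)]
          inverse_commutes[OF tgen_inverse(1,2) ZW'] that])
  have Vi: "app (tgen (Gominv' i)) v \<in> annih Z" if "v \<in> annih Z" for i v
    by (rule annih_torus[OF inverse_commutes[OF tgen_inverse(3,4) torus_tE_ex(2)]
          inverse_commutes[OF tgen_inverse(3,4) ZV'] that])
  have gen: "app (tgen g) v \<in> annih Z" if "v \<in> annih Z" for g v
  proof (cases g)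
    case (Ge j)
    show ?thesis unfolding Ge tgen.simps by (rule annih_tE[OF that])
  next
    case (Gf j)
    show ?thesis unfolding Gf tgen.simps
      by (rule annih_tF[OF W[unfolded tgen.simps] V[unfolded tgen.simps] ZF that])
  qed (simp_all only: W V Wi Vi that)
  have word: "app (prod_list (map tgen gs)) v \<in> annih Z" if "v \<in> annih Z" for gs v
    using that by (induction gs arbitrary: v) (simp_all add: op_simps gen)
  show ?thesis
  proof (induction x rule: single_add_induct)
    case zero
    then show ?case by (simp add: teval_def E.free_eval_0 op_simps annih_0)
  next
    case (add w c x)
    have "app (prod_list (map tgen (letters w))) u \<in> annih Z" by (rule word[OF u])
    from annih_linear[OF this add, of c 1]
    show ?case by (simp add: teval_def E.free_eval_add E.free_eval_single op_simps E.word_eval_def)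
  qed
qed

definition "serre_functionals = annih T.e.S12 \<inter> annih T.e.S21"

lemma serre_functionals_teval: "u \<in> serre_functionals \<Longrightarrow> app (teval x) u \<in> serre_functionals"
proof -
  assume u: "u \<in> serre_functionals"
  have "\<exists>q. tW j * T.e.S12 = escale q (T.e.S12 * tW j)" "\<exists>q. tV j * T.e.S12 = escale q (T.e.S12 * tV j)" for j
    by (cases j; simp only: T.S12_torus)+
  moreover have "T.e.S12 * tF j = tF j * T.e.S12" for j
    by (cases j; simp only: T.S12_c T.S12_d)
  ultimately have "app (teval x) u \<in> annih T.e.S12"
    using u[unfolded serre_functionals_def, THEN IntD1] by (rule annih_teval)
  have "\<exists>q. tW j * T.e.S21 = escale q (T.e.S21 * tW j)" "\<exists>q. tV j * T.e.S21 = escale q (T.e.S21 * tV j)" for j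
    by (cases j; simp only: T.S21_torus)+
  moreover have "T.e.S21 * tF j = tF j * T.e.S21" for j
    by (cases j; simp only: T.S21_c T.S21_d)
  ultimately have "app (teval x) u \<in> annih T.e.S21"
    using u[unfolded serre_functionals_def, THEN IntD2] by (rule annih_teval)
  with \<open>app (teval x) u \<in> annih T.e.S12\<close> show ?thesis
    unfolding serre_functionals_def by (rule IntI)
qed

lemma annihD: "u \<in> annih Z \<Longrightarrow> app Z u = (\<lambda>_. 0)"
  unfolding annih_def by (drule CollectD, drule spec[of _ "[]"]) simp

lemmas teval_simps = E.free_eval_0 E.free_eval_1 E.free_eval_add E.free_eval_diff E.free_eval_mult
  E.free_eval_power free_eval_fgen[OF E.algebra_over_axioms] free_eval_fscale[OF E.algebra_over_axioms]

text \<open>The relations hold as operator identities, except the Serre relations for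
  \<open>e\<close>: these are only known to annihilate the Serre functionals.\<close>

lemma teval_rel:
  assumes "G2_rel x y" "u \<in> serre_functionals"
  shows "app (teval (x - y)) u = (\<lambda>_. 0)"
proof -
  have u: "app T.e.S12 u = (\<lambda>_. 0)" "app T.e.S21 u = (\<lambda>_. 0)"
    using assms(2) by (simp_all add: serre_functionals_def annihD)
  have eqI: ?thesis if "teval x = teval y"
    using that by (simp add: teval_def E.free_eval_diff app_simps)
  note eval = teval_def teval_simps tgen.simps
  show ?thesis
    using assms(1)
  proof cases
    case (comm g h)
    have "tgen g * tgen h = tgen h * tgen g"
      using comm(3,4) by (auto simp: torus_gens_def intro!: endo_eqI simp: op_simps)
    then show ?thesis by (intro eqI) (simp only: comm teval_def teval_simps)
  next
    case (om_inv i)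
    show ?thesis
      by (intro eqI) (simp only: om_inv teval_def teval_simps tgen_inverse)
  next
    case (om'_inv i)
    show ?thesis
      by (intro eqI) (simp only: om'_inv teval_def teval_simps tgen_inverse)
  next
    case (om_e j i)
    show ?thesis
      by (intro eqI) (simp only: om_e eval tW_tE[THEN E.left_rule] E.scale_mult_left mult.assoc
        tgen_inverse[unfolded tgen.simps] mult_1_right)
  next
    case (om_f j i)
    show ?thesis
      by (intro eqI) (simp only: om_f eval tW_tF[THEN E.left_rule] E.scale_mult_left mult.assoc
        tgen_inverse[unfolded tgen.simps] mult_1_right)
  next
    case (om'_e j i)
    show ?thesis
      by (intro eqI) (simp only: om'_e eval tV_tE[THEN E.left_rule] E.scale_mult_left mult.assoc
        tgen_inverse[unfolded tgen.simps] mult_1_right)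
  next
    case (om'_f j i)
    show ?thesis
      by (intro eqI) (simp only: om'_f eval tV_tF[THEN E.left_rule] E.scale_mult_left mult.assoc
        tgen_inverse[unfolded tgen.simps] mult_1_right)
  next
    case (ef i j)
    show ?thesis
      by (intro eqI, cases "i = j") (simp_all only: ef eval tE_tF if_True if_False refl add_diff_cancel_left' diff_self)
  next
    case serre_e21
    have "teval (x - y) = escale (inverse ((rr * ss) ^ 3)) T.e.S21"
      unfolding serre_e21 eval T.e.S21_eq[OF rr_nz ss_nz, symmetric] diff_0_right ..
    then show ?thesis by (simp only: escale.rep_eq u mult_zero_right)
  next
    case serre_e12
    have "teval (x - y) = T.e.S12"
      unfolding serre_e12 eval T.e.S12_eq[symmetric] diff_0_right ..
    then show ?thesis by (simp only: u)
  next
    case serre_f21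
    have "teval (x - y) = escale (inverse ((rr * ss) ^ 3)) T.f.SY21"
      unfolding serre_f21 eval T.f.SY21_eq[OF rr_nz ss_nz, symmetric] diff_0_right ..
    then show ?thesis by (simp only: escale.rep_eq SY21_eq_0 zero_endo.rep_eq mult_zero_right)
  next
    case serre_f12
    have "teval (x - y) = T.f.SY12"
      unfolding serre_f12 eval T.f.SY12_eq[symmetric] diff_0_right ..
    then show ?thesis by (simp only: SY12_eq_0 zero_endo.rep_eq)
  qed
qed

lemma teval_ideal: "x \<in> G2_ideal \<Longrightarrow> u \<in> serre_functionals \<Longrightarrow> app (teval x) u = (\<lambda>_. 0)"
proof (induction rule: G2_ideal.induct)
  case zero
  show ?case by (simp only: teval_def E.free_eval_0 zero_endo.rep_eq)
next
  case (add_gen a b z p q)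
  \<comment> \<open>The factor \<open>p\<close> acts first and stays within the Serre functionals,
    so \<open>a - b\<close> gives zero, which \<open>q\<close> preserves.\<close>
  have rel: "app (teval (a - b)) (app (teval p) u) = (\<lambda>_. 0)"
    by (rule teval_rel[OF add_gen(1) serre_functionals_teval[OF add_gen(4)]])
  have "app (teval (p * (a - b) * q)) u = (\<lambda>_. 0)"
    by (simp only: teval_def E.free_eval_mult times_endo.rep_eq)
      (simp only: rel[unfolded teval_def] app_0)
  with add_gen(3)[OF add_gen(4)] show ?case
    by (simp only: teval_def E.free_eval_add plus_endo.rep_eq add_0)
qed

section \<open>Quantum root vectors in a quantum torus\<close>

text \<open>
  The variables with even index have the type of \<open>e\<^sub>1\<close>, those with odd index the type of \<open>e\<^sub>2\<close>. With
  \<open>q = r / s\<close> and monomials normally ordered as \<open>x5 x3 x1 x4 x2 x0\<close>, all reordering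
  coefficients are polynomials in \<open>q, s\<close>.
\<close>

locale quantum_torus = algebra_over scale
  for scale :: "'k::field \<Rightarrow> 'a::{ring,monoid_mult} \<Rightarrow> 'a" (infixr "*s" 75) +
  fixes r q s :: 'k and x0 x1 x2 x3 x4 x5 :: 'a
  assumes r_eq: "r = q * s"
    and x02: "x0 * x2 = q *s (x2 * x0)"
    and x04: "x0 * x4 = q *s (x4 * x0)"
    and x24: "x2 * x4 = q *s (x4 * x2)"
    and x13: "x1 * x3 = q ^ 3 *s (x3 * x1)"
    and x15: "x1 * x5 = q ^ 3 *s (x5 * x1)"
    and x35: "x3 * x5 = q ^ 3 *s (x5 * x3)"
    and x01: "x0 * x1 = s ^ 3 *s (x1 * x0)"
    and x03: "x0 * x3 = s ^ 3 *s (x3 * x0)"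
    and x05: "x0 * x5 = s ^ 3 *s (x5 * x0)"
    and x23: "x2 * x3 = s ^ 3 *s (x3 * x2)"
    and x25: "x2 * x5 = s ^ 3 *s (x5 * x2)"
    and x45: "x4 * x5 = s ^ 3 *s (x5 * x4)"
    and x21: "x2 * x1 = (q ^ 3 * s ^ 3) *s (x1 * x2)"
    and x41: "x4 * x1 = (q ^ 3 * s ^ 3) *s (x1 * x4)"
    and x43: "x4 * x3 = (q ^ 3 * s ^ 3) *s (x3 * x4)"
begin

lemmas x_rules = x02 x04 x24 x13 x15 x35 x01 x03 x05 x23 x25 x45 x21 x41 x43
lemmas nf = x_rules x_rules[THEN left_rule] r_eq normalize

sublocale root_vectors scale r s "x0 + x2 + x4" "x1 + x3 + x5" ..

text \<open>The root vectors with their common scalars split off, so that the leading monomials get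
  coefficient 1.\<close>

definition "M12 = x1 * x2 + x1 * x4 + x3 * x4"
definition "M112 = x1 * x2 ^ 2 + (q + 1) *s (x1 * x4 * x2) + x1 * x4 ^ 2 + x3 * x4 ^ 2"
definition "M1112 = x1 * x2 ^ 3 + (q ^ 2 + q + 1) *s (x1 * x4 * x2 ^ 2)
  + (q ^ 2 + q + 1) *s (x1 * x4 ^ 2 * x2) + x1 * x4 ^ 3 + x3 * x4 ^ 3"
definition "M11212 = x1 ^ 2 * x2 ^ 3 + (q ^ 2 + q + 1) *s (x1 ^ 2 * x4 * x2 ^ 2)
  + (q ^ 2 + q + 1) *s (x1 ^ 2 * x4 ^ 2 * x2) + (q ^ 2 + q + 1) *s (x3 * x1 * x4 ^ 2 * x2)
  + x1 ^ 2 * x4 ^ 3 + (q ^ 3 + 1) *s (x3 * x1 * x4 ^ 3) + x3 ^ 2 * x4 ^ 3"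

text \<open>For j even and i odd, the bracket of x_j and x_i vanishes if j < i, where the
  commutation scalar is s^3, and is s^3 (q^3 - 1) x_i x_j if j > i. Three products remain.\<close>

lemma X12_M12: "X12 = (s ^ 3 * (q ^ 3 - 1)) *s M12"
  unfolding X12_def M12_def by (simp add: nf)

lemma M112_bracket: "(x0 + x2 + x4) * M12 - (r * s ^ 2) *s (M12 * (x0 + x2 + x4))
  = (s ^ 3 * q * (q ^ 2 - 1)) *s M112"
  unfolding M112_def M12_def by (simp add: nf)

lemma M1112_bracket: "(x0 + x2 + x4) * M112 - (r ^ 2 * s) *s (M112 * (x0 + x2 + x4))
  = (s ^ 3 * q ^ 2 * (q - 1)) *s M1112"
  unfolding M1112_def M112_def by (simp add: nf)

lemma M11212_bracket: "M112 * M12 - (r ^ 2 * s) *s (M12 * M112)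
  = (s ^ 6 * q ^ 5 * (q - 1)) *s M11212"
  unfolding M11212_def M112_def M12_def by (simp add: nf)

lemma M1112_serre: "(x0 + x2 + x4) * M1112 = r ^ 3 *s (M1112 * (x0 + x2 + x4))"
  unfolding M1112_def by (simp add: nf)

lemma M12_serre: "M12 * (x1 + x3 + x5) = r ^ 3 *s ((x1 + x3 + x5) * M12)"
  unfolding M12_def by (simp add: nf)

lemma X112_M112: "X112 = (s ^ 6 * q * (q ^ 3 - 1) * (q ^ 2 - 1)) *s M112"
proof -
  have "X112 = (s ^ 3 * (q ^ 3 - 1)) *s ((x0 + x2 + x4) * M12 - (r * s ^ 2) *s (M12 * (x0 + x2 + x4)))"
    unfolding X112_def X12_M12 scale_mult_left scale_mult_right scale_right_diff_distrib scale_scale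
    by (simp add: mult_ac)
  then show ?thesis
    unfolding M112_bracket by (simp add: eval_nat_numeral mult_ac)
qed

lemma X1112_M1112: "X1112 = (s ^ 9 * q ^ 3 * (q ^ 3 - 1) * (q ^ 2 - 1) * (q - 1)) *s M1112"
proof -
  have "X1112 = (s ^ 6 * q * (q ^ 3 - 1) * (q ^ 2 - 1)) *s
      ((x0 + x2 + x4) * M112 - (r ^ 2 * s) *s (M112 * (x0 + x2 + x4)))"
    unfolding X1112_def X112_M112 scale_mult_left scale_mult_right scale_right_diff_distrib scale_scale
    by (simp add: mult_ac)
  then show ?thesis
    unfolding M1112_bracket by (simp add: eval_nat_numeral mult_ac)
qed

lemma X11212_M11212: "X11212 = (s ^ 15 * q ^ 6 * (q ^ 3 - 1) ^ 2 * (q ^ 2 - 1) * (q - 1)) *s M11212"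
proof -
  have "X11212 = ((s ^ 6 * q * (q ^ 3 - 1) * (q ^ 2 - 1)) * (s ^ 3 * (q ^ 3 - 1))) *s
      (M112 * M12 - (r ^ 2 * s) *s (M12 * M112))"
    unfolding X11212_def X112_M112 X12_M12 scale_mult_left scale_mult_right scale_right_diff_distrib scale_scale
    by (simp add: mult_ac)
  then show ?thesis
    unfolding M11212_bracket by (simp add: eval_nat_numeral mult_ac)
qed

lemma S12_eq_0: "S12 = 0"
  unfolding S12_def X1112_M1112 scale_mult_left scale_mult_right M1112_serre by (simp add: mult_ac)

lemma S21_eq_0: "S21 = 0"
  unfolding S21_def X12_M12 scale_mult_left scale_mult_right M12_serre by (simp add: mult_ac)

end

section \<open>Leading terms\<close>

definition itype :: "nat \<Rightarrow> idx" where "itype k = (if even k then I1 else I2)"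

text \<open>The scalar that arises when x_k is moved past every x_l with l < k in the monomial with
  exponent \<open>m\<close>. Hence \<open>xop k\<close> below is the transpose of left
  multiplication by x_k on monomials ordered by increasing index.\<close>

definition torus_char :: "nat \<Rightarrow> nat multiset \<Rightarrow> K"
  where "torus_char k m = (\<Prod>l<k. inverse (pairing (itype k) (itype l)) ^ count m l)"

lemma torus_char_nz [simp]: "torus_char k m \<noteq> 0"
  by (simp add: torus_char_def del: pairing.simps)

lemma torus_char_add:
  "torus_char k (add_mset l m) =
     (if l < k then inverse (pairing (itype k) (itype l)) else 1) * torus_char k m"
proof (cases "l < k")
  case True
  then have "torus_char k (add_mset l m) = inverse (pairing (itype k) (itype l)) *
      inverse (pairing (itype k) (itype l)) ^ count m l *
      (\<Prod>i\<in>{..<k}-{l}. inverse (pairing (itype k) (itype i)) ^ count m i)"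
    unfolding torus_char_def by (subst prod.remove[of _ l]) auto
  moreover have "torus_char k m = inverse (pairing (itype k) (itype l)) ^ count m l *
      (\<Prod>i\<in>{..<k}-{l}. inverse (pairing (itype k) (itype i)) ^ count m i)"
    unfolding torus_char_def using True by (subst prod.remove[of _ l]) auto
  ultimately show ?thesis using True by (simp add: mult.assoc)
next
  case False
  then show ?thesis by (auto simp: torus_char_def intro!: prod.cong)
qed

definition xop :: "nat \<Rightarrow> (nat multiset, K) endo"
  where "xop k = shift (add_mset k) * diag (torus_char k)"

lemma app_xop: "app (xop k) u m = torus_char k m * u (add_mset k m)"
  by (simp add: xop_def app_simps shift.rep_eq diag.rep_eq)

lemma xop_commute:
  assumes "l < k" and "pairing (itype k) (itype l) = c"
  shows "xop l * xop k = escale c (xop k * xop l)"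
  using assms(1) unfolding assms(2)[symmetric]
  by (intro endo_eqI) (simp add: app_simps app_xop torus_char_add add_mset_commute del: pairing.simps)

lemma xop_commute':
  assumes "l < k" and "inverse (pairing (itype k) (itype l)) = c"
  shows "xop k * xop l = escale c (xop l * xop k)"
  unfolding xop_commute[OF assms(1) refl] assms(2)[symmetric] by (simp del: pairing.simps)

global_interpretation W: quantum_torus escale rr "rr / ss" ss "xop 0" "xop 1" "xop 2" "xop 3" "xop 4" "xop 5"
proof unfold_locales
  have pairings: "rr * inverse ss = rr / ss" "rr ^ 3 * inverse (ss ^ 3) = (rr / ss) ^ 3"
    "inverse (inverse (rr ^ 3)) = (rr / ss) ^ 3 * ss ^ 3"
    by (simp_all add: field_simps)
  show "xop 0 * xop 2 = escale (rr / ss) (xop 2 * xop 0)"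
    "xop 0 * xop 4 = escale (rr / ss) (xop 4 * xop 0)"
    "xop 2 * xop 4 = escale (rr / ss) (xop 4 * xop 2)"
    "xop 1 * xop 3 = escale ((rr / ss) ^ 3) (xop 3 * xop 1)"
    "xop 1 * xop 5 = escale ((rr / ss) ^ 3) (xop 5 * xop 1)"
    "xop 3 * xop 5 = escale ((rr / ss) ^ 3) (xop 5 * xop 3)"
    "xop 0 * xop 1 = escale (ss ^ 3) (xop 1 * xop 0)"
    "xop 0 * xop 3 = escale (ss ^ 3) (xop 3 * xop 0)"
    "xop 0 * xop 5 = escale (ss ^ 3) (xop 5 * xop 0)"
    "xop 2 * xop 3 = escale (ss ^ 3) (xop 3 * xop 2)"
    "xop 2 * xop 5 = escale (ss ^ 3) (xop 5 * xop 2)"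
    "xop 4 * xop 5 = escale (ss ^ 3) (xop 5 * xop 4)"
    by (rule xop_commute; simp add: itype_def pairings del: power_divide)+
  show "rr = rr / ss * ss" by simp
  show "xop 2 * xop 1 = escale ((rr / ss) ^ 3 * ss ^ 3) (xop 1 * xop 2)"
    "xop 4 * xop 1 = escale ((rr / ss) ^ 3 * ss ^ 3) (xop 1 * xop 4)"
    "xop 4 * xop 3 = escale ((rr / ss) ^ 3 * ss ^ 3) (xop 3 * xop 4)"
    by (rule xop_commute'; simp only: itype_def pairings pairing.simps; simp add: pairings power_divide)+
qed

text \<open>
  These weights make \<open>x5, x3 x4, x3\<^sup>2 x4\<^sup>3, x1 x2\<^sup>2, x1 x2\<^sup>3, x0\<close> the leading monomials of the six root
  vectors; they are chosen so that these exponents are linearly independent.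
\<close>

definition wt :: "nat multiset \<Rightarrow> nat"
  where "wt m = 4 * count m 0 + 3 * count m 2 + 5 * count m 3 + 6 * count m 5"

lemma wt_add: "wt (m + m') = wt m + wt m'"
  by (simp add: wt_def)

text \<open>
  In terms of functionals, \<open>Z x\<^sup>m\<close> has highest term \<open>c x\<^sup>m\<^sup>+\<^sup>e\<close>: the terms of smaller weight
  are removed by testing only functionals that vanish on them.
\<close>

definition lead :: "nat multiset \<Rightarrow> (nat multiset, 'k::field) endo \<Rightarrow> bool"
  where "lead e Z \<longleftrightarrow> (\<forall>m. \<exists>c. c \<noteq> 0 \<and>
    (\<forall>u. (\<forall>m'. wt m' < wt m + wt e \<longrightarrow> u m' = 0) \<longrightarrow> app Z u m = c * u (m + e)))"

definition below :: "nat \<Rightarrow> (nat multiset, 'k::field) endo \<Rightarrow> bool"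
  where "below d Z \<longleftrightarrow> (\<forall>m u. (\<forall>m'. wt m' < wt m + d \<longrightarrow> u m' = 0) \<longrightarrow> app Z u m = 0)"

lemma lead_1: "lead {#} 1"
  unfolding lead_def by (auto simp: app_simps intro!: exI[of _ 1])

lemma lead_xop: "lead {#k#} (xop k)"
  unfolding lead_def by (auto simp: app_xop intro!: exI[of _ "torus_char k _"])

lemma lead_mult:
  assumes "lead e Z" "lead e' Z'"
  shows "lead (e + e') (Z * Z')"
  unfolding lead_def
proof
  fix m
  obtain c where c: "c m \<noteq> 0" "\<And>u. (\<forall>m'. wt m' < wt m + wt e \<longrightarrow> u m' = 0) \<Longrightarrow> app Z u m = c m * u (m + e)" for m
    using assms(1) unfolding lead_def by metis
  obtain c' where c': "c' m \<noteq> 0" "\<And>u. (\<forall>m'. wt m' < wt m + wt e' \<longrightarrow> u m' = 0) \<Longrightarrow> app Z' u m = c' m * u (m + e')" for m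
    using assms(2) unfolding lead_def by metis
  show "\<exists>c. c \<noteq> 0 \<and> (\<forall>u. (\<forall>m'. wt m' < wt m + wt (e + e') \<longrightarrow> u m' = 0) \<longrightarrow>
    app (Z * Z') u m = c * u (m + (e + e')))"
  proof (intro exI[of _ "c' m * c (m + e')"] conjI allI impI)
    show "c' m * c (m + e') \<noteq> 0" using c(1) c'(1) by simp
    fix u :: "nat multiset \<Rightarrow> 'a"
    assume u: "\<forall>m'. wt m' < wt m + wt (e + e') \<longrightarrow> u m' = 0"
    \<comment> \<open>This shows that \<open>app Z u\<close> is an admissible test functional for
      the leading term of \<open>Z'\<close>.\<close>
    have "app Z u m' = 0" if "wt m' < wt m + wt e'" for m'
      using c(2)[of m' u] u that by (simp add: wt_add)
    then have "app Z' (app Z u) m = c' m * app Z u (m + e')"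
      by (intro c'(2)) blast
    also have "app Z u (m + e') = c (m + e') * u (m + e' + e)"
      using u by (intro c(2)) (simp add: wt_add)
    finally show "app (Z * Z') u m = c' m * c (m + e') * u (m + (e + e'))"
      by (simp add: app_simps add_ac mult.assoc)
  qed
qed

lemma lead_power: "lead e Z \<Longrightarrow> lead (repeat_mset n e) (Z ^ n)"
  by (induction n) (simp_all add: lead_1 lead_mult)

lemma lead_scale: assumes "lead e Z" "c \<noteq> 0" shows "lead e (escale c Z)"
  unfolding lead_def
proof
  fix m
  from assms(1) obtain d where "d \<noteq> 0"
    "\<forall>u. (\<forall>m'. wt m' < wt m + wt e \<longrightarrow> u m' = 0) \<longrightarrow> app Z u m = d * u (m + e)"
    unfolding lead_def by blast
  with assms(2) show "\<exists>d. d \<noteq> 0 \<and> (\<forall>u. (\<forall>m'. wt m' < wt m + wt e \<longrightarrow> u m' = 0) \<longrightarrow>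
      app (escale c Z) u m = d * u (m + e))"
    by (intro exI[of _ "c * d"]) (simp add: app_simps)
qed

lemma lead_imp_below: assumes "lead e Z" "wt e < d" shows "below d Z"
  unfolding below_def
proof (intro allI impI)
  fix m and u :: "nat multiset \<Rightarrow> 'a"
  assume u: "\<forall>m'. wt m' < wt m + d \<longrightarrow> u m' = 0"
  obtain c where "app Z u m = c * u (m + e)"
    using assms u unfolding lead_def by (metis add_strict_left_mono less_trans)
  then show "app Z u m = 0" using u assms(2) by (simp add: wt_add)
qed

lemma below_add: "below d Y \<Longrightarrow> below d Z \<Longrightarrow> below d (Y + Z)"
  by (simp add: below_def app_simps)

lemma below_scale: "below d Z \<Longrightarrow> below d (escale c Z)"
  by (simp add: below_def app_simps)

lemma lead_add: assumes "lead e Y" "below (wt e) Z" shows "lead e (Y + Z)"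
  unfolding lead_def
proof
  fix m
  from assms(1) obtain d where "d \<noteq> 0"
    "\<forall>u. (\<forall>m'. wt m' < wt m + wt e \<longrightarrow> u m' = 0) \<longrightarrow> app Y u m = d * u (m + e)"
    unfolding lead_def by blast
  with assms(2) show "\<exists>d. d \<noteq> 0 \<and> (\<forall>u. (\<forall>m'. wt m' < wt m + wt e \<longrightarrow> u m' = 0) \<longrightarrow>
      app (Y + Z) u m = d * u (m + e))"
    by (intro exI[of _ d]) (simp add: app_simps below_def)
qed

lemma lead_add': "below (wt e) Y \<Longrightarrow> lead e Z \<Longrightarrow> lead e (Y + Z)"
  unfolding add.commute[of Y] by (rule lead_add)

lemmas below_xop = lead_imp_below[OF lead_xop]

lemma lead_E2: "lead {#5#} (xop 1 + xop 3 + xop 5)"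
  by (intro lead_add' below_add lead_xop; rule below_xop; simp add: wt_def)

lemma lead_E1: "lead {#0#} (xop 0 + xop 2 + xop 4)"
  by (intro lead_add lead_xop; rule below_xop; simp add: wt_def)

lemmas lead_monomial = lead_mult lead_power lead_xop

lemma lead_M12: "lead ({#3#} + {#4#}) W.M12"
  unfolding W.M12_def
  by (intro lead_add' below_add lead_monomial; (rule lead_imp_below, (rule lead_monomial)+, simp add: wt_def))

text \<open>The closest comparison is x3^2 x4^3 of weight 10 against x1^2 x2^3 of weight 9. In
  \<open>lead_M112\<close>, x1 x2^2 of weight 6 beats x3 x4^2 of weight 5.\<close>

lemma lead_M11212: "lead (repeat_mset 2 {#3#} + repeat_mset 3 {#4#}) W.M11212"
  unfolding W.M11212_def
  by (intro lead_add' below_add below_scale lead_monomial; (rule lead_imp_below, (rule lead_monomial)+, simp add: wt_def))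

lemma lead_M112: "lead ({#1#} + repeat_mset 2 {#2#}) W.M112"
  unfolding W.M112_def
  by (intro lead_add below_scale lead_monomial; (rule lead_imp_below, (rule lead_monomial)+, simp add: wt_def))

lemma lead_M1112: "lead ({#1#} + repeat_mset 3 {#2#}) W.M1112"
  unfolding W.M1112_def
  by (intro lead_add below_scale lead_monomial; (rule lead_imp_below, (rule lead_monomial)+, simp add: wt_def))

lemma generic_nz:
  "rr + ss \<noteq> 0" "rr ^ 2 + ss ^ 2 \<noteq> 0" "rr ^ 2 - rr * ss + ss ^ 2 \<noteq> 0"
  "rr - ss \<noteq> 0" "rr ^ 2 - ss ^ 2 \<noteq> 0" "rr ^ 3 - ss ^ 3 \<noteq> 0"
  by (simp_all add: rr_def ss_def Zero_fract_def eq_fract eval_nat_numeral)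

lemma q_nz: "rr / ss - 1 \<noteq> 0" "(rr / ss) ^ 2 - 1 \<noteq> 0" "(rr / ss) ^ 3 - 1 \<noteq> 0"
  using generic_nz(4-6) by (simp_all add: power_divide)

definition lead_exp :: "nat \<times> nat \<times> nat \<times> nat \<times> nat \<times> nat \<Rightarrow> nat multiset" where
  "lead_exp = (\<lambda>(n1, n2, n3, n4, n5, n6). repeat_mset n1 {#5#} + repeat_mset n2 ({#3#} + {#4#})
     + repeat_mset n3 (repeat_mset 2 {#3#} + repeat_mset 3 {#4#})
     + repeat_mset n4 ({#1#} + repeat_mset 2 {#2#}) + repeat_mset n5 ({#1#} + repeat_mset 3 {#2#})
     + repeat_mset n6 {#0#})"

lemma lead_lyndon: "lead (lead_exp n) (W.lyndon n)"
proof -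
  have "lead ({#3#} + {#4#}) W.X12" "lead (repeat_mset 2 {#3#} + repeat_mset 3 {#4#}) W.X11212"
    "lead ({#1#} + repeat_mset 2 {#2#}) W.X112" "lead ({#1#} + repeat_mset 3 {#2#}) W.X1112"
    unfolding W.X12_M12 W.X112_M112 W.X1112_M1112 W.X11212_M11212
    by ((rule lead_scale, rule lead_M12 lead_M112 lead_M1112 lead_M11212, use q_nz in simp)+)
  then show ?thesis
    by (cases n) (simp only: lead_exp_def W.lyndon_def prod.case lead_mult lead_power lead_E1 lead_E2)
qed

text \<open>Indices 5 and 0 recover n1 and n6; indices 3 and 4 give n2 + 2 n3 and n2 + 3 n3; indices
  1 and 2 give n4 + n5 and 2 n4 + 3 n5.\<close>

lemma inj_lead_exp: "inj lead_exp"
proof (rule injI)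
  fix n n' assume "lead_exp n = lead_exp n'"
  then have "count (lead_exp n) k = count (lead_exp n') k" for k by simp
  from this[of 0] this[of 1] this[of 2] this[of 3] this[of 4] this[of 5]
  show "n = n'" by (cases n; cases n') (simp add: lead_exp_def)
qed

section \<open>The basis theorem\<close>

global_interpretation UA: root_vectors Uscale rr ss e1 e2
proof unfold_locales
  fix c :: K and x y :: UG2
  show "(c *\<^sub>U x) * y = c *\<^sub>U (x * y)"
    by transfer (simp add: fscale_def mult.assoc G2_cong_refl)
  show "x * (c *\<^sub>U y) = c *\<^sub>U (x * y)"
    by transfer (simp add: F.scale_mult_right G2_cong_refl)
qed

lemma abs_rel: "G2_rel x y \<Longrightarrow> abs_UG2 x = abs_UG2 y"
  using G2_ideal.add_gen[of x y 0 1 1] G2_ideal.zero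
  by (simp add: UG2.abs_eq_iff G2_cong_def)

lemma abs_power: "abs_UG2 (x ^ n) = abs_UG2 x ^ n"
  by (induction n) (simp_all add: one_UG2_def times_UG2.abs_eq[symmetric])

lemmas abs_simps = times_UG2.abs_eq[symmetric] plus_UG2.abs_eq[symmetric] minus_UG2.abs_eq[symmetric]
  Uscale.abs_eq[symmetric] abs_power one_UG2_def[symmetric] zero_UG2_def[symmetric]

lemma e_abs: "abs_UG2 (fe I1) = e1" "abs_UG2 (fe I2) = e2"
  by (simp_all add: e1_def e2_def Ugen.abs_eq)

global_interpretation UA: serre_algebra Uscale rr ss e1 e2
proof unfold_locales
  have "inverse ((rr * ss) ^ 3) *\<^sub>U UA.S21 = 0"
    using abs_rel[OF serre_e21] unfolding UA.S21_eq[OF rr_nz ss_nz, symmetric]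
    by (simp only: abs_simps e_abs)
  then have "UA.S21 = 0" by (simp only: U.scale_eq_0_iff) simp
  then show "UA.X12 * e2 = rr ^ 3 *\<^sub>U (e2 * UA.X12)" by (simp add: UA.S21_def)
  have "UA.S12 = 0"
    using abs_rel[OF serre_e12] unfolding UA.S12_eq[symmetric]
    by (simp only: abs_simps e_abs)
  then show "e1 * UA.X1112 = rr ^ 3 *\<^sub>U (UA.X1112 * e1)" by (simp add: UA.S12_def)
qed (simp_all only: rr_nz ss_nz generic_nz not_False_eq_True)

lemma lyndon_monomial_eq: "lyndon_monomial = UA.lyndon"
  unfolding lyndon_monomial_def UA.lyndon_def E1_def E2_def E12_def E112_def E1112_def E11212_def
    UA.X12_def UA.X112_def UA.X1112_def UA.X11212_def ..

lemma subalg_gen_power: "x \<in> subalg_gen S \<Longrightarrow> x ^ n \<in> subalg_gen S"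
  by (induction n) (auto intro: subalg_gen.one subalg_gen.mult)

lemma subalg_gen_diff: "x \<in> subalg_gen S \<Longrightarrow> y \<in> subalg_gen S \<Longrightarrow> x - y \<in> subalg_gen S"
  using subalg_gen.add[OF _ subalg_gen.scale[of y S "-1"], of x] by simp

lemma lyndon_Uplus: "UA.lyndon n \<in> Uplus"
  unfolding Uplus_def UA.lyndon_def UA.X12_def UA.X112_def UA.X1112_def UA.X11212_def
  by (cases n) (auto intro!: subalg_gen_power subalg_gen_diff subalg_gen.mult subalg_gen.scale
    intro: subalg_gen.base)

lemma span_lyndon: "U.span (range UA.lyndon) = Uplus"
proof
  have "0 \<in> Uplus"
    using subalg_gen.scale[OF subalg_gen.one, of 0] by (simp add: Uplus_def)
  then have "U.subspace Uplus"
    by (auto intro!: U.subspaceI simp: Uplus_def intro: subalg_gen.add subalg_gen.scale)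
  then show "U.span (range UA.lyndon) \<subseteq> Uplus"
    using lyndon_Uplus by (intro U.span_minimal) auto
  show "Uplus \<subseteq> U.span (range UA.lyndon)"
  proof
    fix x assume "x \<in> Uplus"
    \<comment> \<open>Generalising to left multiplication on the whole span lets products be treated
      by composition; y = 1 then recovers \<open>x\<close>.\<close>
    then have "x * y \<in> U.span (range UA.lyndon)" if "y \<in> U.span (range UA.lyndon)" for y
      unfolding Uplus_def using that
    proof (induction arbitrary: y rule: subalg_gen.induct)
      case (base x)
      then show ?case using UA.a_span_lyndon UA.b_span_lyndon by blast
    next
      case (scale x c)
      then show ?case by (simp add: UA.scale_mult_left U.span_scale)
    next
      case (add x x')
      then show ?case by (simp add: distrib_right U.span_add)
    next
      case (mult x x')
      then show ?case by (simp add: mult.assoc)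
    qed simp
    moreover have "1 \<in> U.span (range UA.lyndon)"
      by (rule U.span_base, rule image_eqI[of _ _ "(0, 0, 0, 0, 0, 0)"]) (simp_all add: UA.lyndon_def)
    ultimately show "x \<in> U.span (range UA.lyndon)" by fastforce
  qed
qed

section \<open>Linear independence through the Feigin homomorphism\<close>

primrec xE :: "idx \<Rightarrow> (nat multiset, K) endo" where
  "xE I1 = xop 0 + xop 2 + xop 4"
| "xE I2 = xop 1 + xop 3 + xop 5"

text \<open>The functionals on words given by the coefficients of the Feigin image.\<close>

definition \<psi> :: "(nat multiset \<Rightarrow> K) \<Rightarrow> idx list \<Rightarrow> K"
  where "\<psi> g w = app (prod_list (map xE w)) g {#}"

text \<open>Compatibility with sums of products is proved step by step, so any expression built from
  the \<open>tE i\<close> can be matched with the same expression in the \<open>xE i\<close>, in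
  particular root vectors and Serre elements.\<close>

definition intertwine :: "(idx list, K) endo \<Rightarrow> (nat multiset, K) endo \<Rightarrow> bool"
  where "intertwine Y Z \<longleftrightarrow> (\<forall>g. app Y (\<psi> g) = \<psi> (app Z g))"

lemma psi_linear: "\<psi> (\<lambda>m. p * u m + q * v m) = (\<lambda>w. p * \<psi> u w + q * \<psi> v w)"
  by (simp add: \<psi>_def app_linear fun_eq_iff)

lemma intertwine_intros:
  "intertwine 1 1"
  "intertwine Y Z \<Longrightarrow> intertwine Y' Z' \<Longrightarrow> intertwine (Y * Y') (Z * Z')"
  "intertwine Y Z \<Longrightarrow> intertwine Y' Z' \<Longrightarrow> intertwine (Y - Y') (Z - Z')"
  "intertwine Y Z \<Longrightarrow> intertwine (escale c Y) (escale c Z)"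
  using psi_linear[of 1 _ "-1"] psi_linear[of c _ 0 "\<lambda>_. 0"]
  by (simp_all add: intertwine_def app_simps)

lemma intertwine_power: "intertwine Y Z \<Longrightarrow> intertwine (Y ^ n) (Z ^ n)"
  by (induction n) (simp_all add: intertwine_intros)

lemma intertwine_tE: "intertwine (tE i) (xE i)"
  by (simp add: intertwine_def app_tE \<psi>_def app_simps fun_eq_iff)

lemma intertwine_gens: "intertwine (tE I1) (xop 0 + xop 2 + xop 4)"
  "intertwine (tE I2) (xop 1 + xop 3 + xop 5)"
  using intertwine_tE[of I1] intertwine_tE[of I2] by simp_all

lemma intertwine_root_vectors: "intertwine T.e.X12 W.X12" "intertwine T.e.X112 W.X112"
  "intertwine T.e.X1112 W.X1112" "intertwine T.e.X11212 W.X11212"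
proof -
  show X12: "intertwine T.e.X12 W.X12"
    unfolding T.e.X12_def W.X12_def by (intro intertwine_intros intertwine_gens)
  show X112: "intertwine T.e.X112 W.X112"
    unfolding T.e.X112_def W.X112_def by (intro intertwine_intros intertwine_gens X12)
  show "intertwine T.e.X1112 W.X1112"
    unfolding T.e.X1112_def W.X1112_def by (intro intertwine_intros intertwine_gens X112)
  show "intertwine T.e.X11212 W.X11212"
    unfolding T.e.X11212_def W.X11212_def by (intro intertwine_intros intertwine_gens X112 X12)
qed

lemma intertwine_serre: "intertwine T.e.S12 0" "intertwine T.e.S21 0"
proof -
  have "intertwine T.e.S12 W.S12"
    unfolding T.e.S12_def W.S12_def by (intro intertwine_intros intertwine_gens intertwine_root_vectors)
  then show "intertwine T.e.S12 0" by (simp only: W.S12_eq_0)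
  have "intertwine T.e.S21 W.S21"
    unfolding T.e.S21_def W.S21_def by (intro intertwine_intros intertwine_gens intertwine_root_vectors)
  then show "intertwine T.e.S21 0" by (simp only: W.S21_eq_0)
qed

lemma intertwine_lyndon: "intertwine (T.e.lyndon n) (W.lyndon n)"
  by (cases n) (simp only: T.e.lyndon_def W.lyndon_def prod.case intertwine_intros intertwine_power
    intertwine_gens intertwine_root_vectors)

lemma psi_annih: assumes "intertwine Z 0" shows "\<psi> g \<in> annih Z"
proof -
  have "intertwine (tEs p) (prod_list (map xE p))" for p
    by (induction p) (simp_all add: intertwine_intros intertwine_tE)
  then have "intertwine (tEs p * Z) 0" for p
    using intertwine_intros(2)[OF _ assms] by fastforce
  then show ?thesis
    using psi_linear[of 0 "\<lambda>_. 0" 0 "\<lambda>_. 0"] by (simp add: annih_def intertwine_def app_simps)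
qed

lemma psi_serre: "\<psi> g \<in> serre_functionals"
  by (simp add: serre_functionals_def psi_annih intertwine_serre)

text \<open>Here the absence of further relations among e_1, e_2 in \<open>U\<close> enters: by
  \<open>teval_ideal\<close> the Feigin coefficients depend only on the class in
  \<open>U\<close>.\<close>

lift_definition torus_functional :: "(nat multiset \<Rightarrow> K) \<Rightarrow> UG2 \<Rightarrow> K"
  is "\<lambda>g x. app (teval x) (\<psi> g) []"
proof -
  fix g x y
  assume "G2_cong x y"
  then have "app (teval (x - y)) (\<psi> g) = (\<lambda>_. 0)"
    unfolding G2_cong_def by (rule teval_ideal[OF _ psi_serre])
  then have "app (teval (x - y)) (\<psi> g) [] = 0" by simp
  then show "app (teval x) (\<psi> g) [] = app (teval y) (\<psi> g) []"
    by (simp add: teval_def E.free_eval_diff app_simps)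
qed

lemma torus_functional_0: "torus_functional g 0 = 0"
  by transfer (simp add: teval_def E.free_eval_0 app_simps)

lemma torus_functional_add: "torus_functional g (x + y) = torus_functional g x + torus_functional g y"
  by transfer (simp add: teval_def E.free_eval_add app_simps)

lemma torus_functional_scale: "torus_functional g (c *\<^sub>U x) = c * torus_functional g x"
  by transfer (simp add: teval_def free_eval_fscale[OF E.algebra_over_axioms] app_simps)

lemma torus_functional_sum: "torus_functional g (\<Sum>n\<in>A. c n *\<^sub>U f n) = (\<Sum>n\<in>A. c n * torus_functional g (f n))"
  by (induction A rule: infinite_finite_induct)
    (simp_all add: torus_functional_0 torus_functional_add torus_functional_scale)

global_interpretation FA: root_vectors fscale rr ss "fe I1" "fe I2" ..

lemma abs_lyndon: "abs_UG2 (FA.lyndon n) = UA.lyndon n"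
  by (cases n) (simp only: FA.lyndon_def UA.lyndon_def prod.case FA.X12_def FA.X112_def FA.X1112_def
    FA.X11212_def UA.X12_def UA.X112_def UA.X1112_def UA.X11212_def abs_simps e_abs)

lemma teval_lyndon: "teval (FA.lyndon n) = T.e.lyndon n"
  by (cases n) (simp only: FA.lyndon_def T.e.lyndon_def prod.case FA.X12_def FA.X112_def FA.X1112_def
    FA.X11212_def T.e.X12_def T.e.X112_def T.e.X1112_def T.e.X11212_def teval_def teval_simps tgen.simps)

lemma torus_functional_lyndon: "torus_functional g (UA.lyndon n) = app (W.lyndon n) g {#}"
  unfolding abs_lyndon[symmetric] torus_functional.abs_eq teval_lyndon
  using intertwine_lyndon by (simp add: intertwine_def \<psi>_def app_simps)

text \<open>Among the monomials with nonzero coefficient, one of maximal leading weight is isolated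
  by testing with the indicator function of its leading exponent.\<close>

lemma lyndon_coeffs_0:
  assumes S: "finite S" and sum: "(\<Sum>n\<in>S. c n *\<^sub>U UA.lyndon n) = 0"
  shows "\<forall>n\<in>S. c n = 0"
proof (rule ccontr)
  define S' where "S' = {n \<in> S. c n \<noteq> 0}"
  assume "\<not> (\<forall>n\<in>S. c n = 0)"
  then have "S' \<noteq> {}" unfolding S'_def by blast
  have "finite S'" using S by (simp add: S'_def)
  define M where "M = Max ((\<lambda>n. wt (lead_exp n)) ` S')"
  have "M \<in> (\<lambda>n. wt (lead_exp n)) ` S'"
    unfolding M_def using \<open>S' \<noteq> {}\<close> \<open>finite S'\<close> by (intro Max_in) simp_all
  then obtain n where n: "n \<in> S'" "wt (lead_exp n) = M" by auto
  have le: "wt (lead_exp n') \<le> wt (lead_exp n)" if "n' \<in> S'" for n'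
    unfolding n(2) M_def using \<open>finite S'\<close> that by (intro Max_ge) simp_all
  let ?g = "\<lambda>m. if m = lead_exp n then 1 else 0 :: K"
  have coeff: "\<exists>d. d \<noteq> 0 \<and> app (W.lyndon n') ?g {#} = d * ?g (lead_exp n')" if "n' \<in> S'" for n'
  proof -
    \<comment> \<open>By maximality the indicator vanishes below the leading weight of
      \<open>n'\<close>, as \<open>lead\<close> demands, so only the leading coefficient of
      \<open>n'\<close> can be seen.\<close>
    have g: "\<forall>m'. wt m' < wt {#} + wt (lead_exp n') \<longrightarrow> ?g m' = 0"
      using le[OF that] by (auto simp: wt_def)
    obtain d where "d \<noteq> 0" and d: "\<forall>u. (\<forall>m'. wt m' < wt {#} + wt (lead_exp n') \<longrightarrow> u m' = 0)
        \<longrightarrow> app (W.lyndon n') u {#} = d * u ({#} + lead_exp n')"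
      using lead_lyndon[of n', unfolded lead_def, THEN spec, of "{#}"] by blast
    have "app (W.lyndon n') ?g {#} = d * ?g ({#} + lead_exp n')"
      by (rule d[THEN spec, of ?g, THEN mp, OF g])
    with \<open>d \<noteq> 0\<close> show ?thesis by (intro exI[of _ d]) simp
  qed
  have "0 = (\<Sum>n'\<in>S. c n' * app (W.lyndon n') ?g {#})"
    using arg_cong[OF sum, of "torus_functional ?g"] by (simp add: torus_functional_sum torus_functional_0 torus_functional_lyndon)
  also have "\<dots> = (\<Sum>n'\<in>S'. c n' * app (W.lyndon n') ?g {#})"
    using S by (intro sum.mono_neutral_right) (auto simp: S'_def)
  also have "\<dots> = (\<Sum>n'\<in>S'. if n' = n then c n * app (W.lyndon n) ?g {#} else 0)"
  proof (rule sum.cong[OF refl])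
    fix n' assume "n' \<in> S'"
    from coeff[OF this] show "c n' * app (W.lyndon n') ?g {#} = (if n' = n then c n * app (W.lyndon n) ?g {#} else 0)"
      using inj_lead_exp by (auto simp: inj_eq)
  qed
  also have "\<dots> = c n * app (W.lyndon n) ?g {#}"
    using \<open>finite S'\<close> n(1) by simp
  finally show False
    using coeff[OF n(1)] n(1) by (auto simp: S'_def)
qed

text \<open>Injectivity belongs to the conclusion because independence of the range alone would not
  exclude repeated monomials.\<close>

lemma (in vector_space) family_independent:
  assumes "\<And>S c. finite S \<Longrightarrow> (\<Sum>n\<in>S. c n *s f n) = 0 \<Longrightarrow> \<forall>n\<in>S. c n = 0"
  shows "inj f \<and> independent (range f)"
proof
  show inj: "inj f"
  proof (rule injI, rule ccontr)
    fix n n' assume eq: "f n = f n'" "n \<noteq> n'"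
    have "(\<Sum>k\<in>{n, n'}. (if k = n then 1 else - 1) *s f k) = 0" using eq by auto
    from assms[OF _ this] show False by auto
  qed
  show "independent (range f)"
    unfolding independent_explicit_module
  proof (intro allI impI)
    fix t u v
    assume t: "finite t" "t \<subseteq> range f" "(\<Sum>v\<in>t. u v *s v) = 0" "v \<in> t"
    define S where "S = f -` t"
    have t': "t = f ` S" using t(2) by (auto simp: S_def)
    have "finite S" unfolding S_def using t(1) inj by (rule finite_vimageI)
    moreover have "(\<Sum>n\<in>S. u (f n) *s f n) = 0"
      using t(3) inj unfolding t' by (subst (asm) sum.reindex) (auto intro: inj_on_subset)
    ultimately show "u v = 0" using assms[of S "\<lambda>n. u (f n)"] t(4) t' by auto
  qed
qed

theorem theorem2p4:
  shows "inj lyndon_monomial \<and>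
    U.independent (range lyndon_monomial) \<and>
    U.span (range lyndon_monomial) = Uplus"
  using U.family_independent[of UA.lyndon] lyndon_coeffs_0 span_lyndon
  unfolding lyndon_monomial_eq by blast

end
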